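(* Let $n\ge 1$, let $f\in C([0,1]\times[0,\infty),[0,\infty))$, let $\alpha\ge 0$, $\beta_i\ge 0$ ($1\le i\le n$), $0<\eta_1<\eta_2<\dots<\eta_n<1$, and suppose $\alpha+\sum_{i=1}^n\beta_i<1$. Let $\theta\in(0,\tfrac12)$ be fixed, and let $\Lambda_2$ be the constant defined in the context. Assume that: (i) $f^0=f^\infty=0$; (ii) there exist constants $\rho_2>0$ and $M_2\in[\Lambda_2,\infty)$ such that $f(t,u)\ge M_2\rho_2$ for all $u\in[\theta^3(1-2\theta)\rho_2,\rho_2]$ and $t\in[\theta,1-\theta]$. Then the boundary value problem $$u''''(t)+f(t,u(t))=0,\quad t\in(0,1),$$ $$u'(0)=u'(1)=u''(0)=0,\qquad u(0)=\alpha\int_0^1u(s)\,ds+\sum_{i=1}^n\beta_iu(\eta_i)$$ has at least two positive solutions $u_1$ and $u_2$ such that $$0<\|u_1\|<\rho_2<\|u_2\|.$$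
   Context: $\|u\|=\sup_{t\in[0,1]}|u(t)|$. The limits, understood in $[0,\infty]$, are $$f^0=\lim_{u\to0^+}\Big\{\max_{0\le t\le1}\frac{f(t,u)}{u}\Big\},\qquad f^\infty=\lim_{u\to+\infty}\Big\{\max_{0\le t\le1}\frac{f(t,u)}{u}\Big\};$$ a hypothesis such as $f^0=0$ means that the limit exists and has the indicated value. Put $k=1-\big(\alpha+\sum_{i=1}^n\beta_i\big)$, $e(s)=\frac16s(1-s)^2$, and $$G(t,s)=\frac16\begin{cases}t^3(1-s)^2-(t-s)^3,&0\le s\le t\le1,\\ t^3(1-s)^2,&0\le t\le s\le1.\end{cases}$$ Define $$\Psi=\theta^6(1-2\theta)^2\int_\theta^{1-\theta}\Big(\Big(1+\frac{\alpha}{k}\Big)e(s)+\frac1k\sum_{i=1}^n\beta_iG(\eta_i,s)\Big)ds,\qquad \Lambda_2=\Psi^{-1}.$$ A solution is a function $u\in C^4([0,1])$ satisfying the differential equation and the boundary conditions; a positive solution is a solution $u$ with $u(t)>0$ for all $t\in(0,1)$. *)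

theory Defs
  imports "HOL-Analysis.Analysis"
begin

text \<open>
  Functions on \<open>[0,1]\<close> are represented by total functions \<open>real \<Rightarrow> real\<close>; nothing below depends
  on their values outside \<open>[0,1]\<close>. At the end points the derivative is one-sided.
\<close>

definition deriv01 :: "(real \<Rightarrow> real) \<Rightarrow> real \<Rightarrow> real" where
  "deriv01 u t = vector_derivative u (at t within {0..1})"

definition Ck01 :: "nat \<Rightarrow> (real \<Rightarrow> real) \<Rightarrow> bool" where
  "Ck01 m u \<longleftrightarrow>
     (\<forall>j<m. (deriv01 ^^ j) u differentiable_on {0..1}) \<and>
     continuous_on {0..1} ((deriv01 ^^ m) u)"

definition sup_norm01 :: "(real \<Rightarrow> real) \<Rightarrow> real" where
  "sup_norm01 u = (SUP t\<in>{0..1}. \<bar>u t\<bar>)"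

text \<open>
  For continuous \<open>f\<close> the supremum of the quotient over the compact interval \<open>[0,1]\<close> is its
  maximum. The limits are taken in the extended reals, and each predicate says that the limit
  exists and equals \<open>L\<close>.
\<close>

definition max_quot :: "(real \<Rightarrow> real \<Rightarrow> real) \<Rightarrow> real \<Rightarrow> real" where
  "max_quot f u = (SUP t\<in>{0..1}. f t u / u)"

definition has_f_zero :: "(real \<Rightarrow> real \<Rightarrow> real) \<Rightarrow> ereal \<Rightarrow> bool" where
  "has_f_zero f L \<longleftrightarrow> ((\<lambda>u. ereal (max_quot f u)) \<longlongrightarrow> L) (at_right 0)"

definition has_f_infty :: "(real \<Rightarrow> real \<Rightarrow> real) \<Rightarrow> ereal \<Rightarrow> bool" where
  "has_f_infty f L \<longleftrightarrow> ((\<lambda>u. ereal (max_quot f u)) \<longlongrightarrow> L) at_top"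

definition k_const :: "nat \<Rightarrow> real \<Rightarrow> (nat \<Rightarrow> real) \<Rightarrow> real" where
  "k_const n \<alpha> \<beta> = 1 - (\<alpha> + (\<Sum>i=1..n. \<beta> i))"

definition e_fun :: "real \<Rightarrow> real" where
  "e_fun s = 1/6 * s * (1 - s)^2"

definition green :: "real \<Rightarrow> real \<Rightarrow> real" where
  "green t s = 1/6 * (if s \<le> t then t^3 * (1 - s)^2 - (t - s)^3 else t^3 * (1 - s)^2)"

definition Psi ::
  "nat \<Rightarrow> real \<Rightarrow> (nat \<Rightarrow> real) \<Rightarrow> (nat \<Rightarrow> real) \<Rightarrow> real \<Rightarrow> real" where
  "Psi n \<alpha> \<beta> \<eta> \<theta> =
     \<theta>^6 * (1 - 2 * \<theta>)^2 *
     integral {\<theta>..1 - \<theta>}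
       (\<lambda>s. (1 + \<alpha> / k_const n \<alpha> \<beta>) * e_fun s
            + 1 / k_const n \<alpha> \<beta> * (\<Sum>i=1..n. \<beta> i * green (\<eta> i) s))"

definition Lambda2 ::
  "nat \<Rightarrow> real \<Rightarrow> (nat \<Rightarrow> real) \<Rightarrow> (nat \<Rightarrow> real) \<Rightarrow> real \<Rightarrow> real" where
  "Lambda2 n \<alpha> \<beta> \<eta> \<theta> = inverse (Psi n \<alpha> \<beta> \<eta> \<theta>)"

text \<open>
  The nonlinearity \<open>f\<close> is only meaningful on \<open>[0,1] \<times> [0,\<infinity>)\<close>, so satisfying the differential
  equation includes \<open>0 \<le> u t\<close>.
\<close>

definition bvp_solution ::
  "(real \<Rightarrow> real \<Rightarrow> real) \<Rightarrow> nat \<Rightarrow> real \<Rightarrow> (nat \<Rightarrow> real) \<Rightarrow> (nat \<Rightarrow> real) \<Rightarrow> (real \<Rightarrow> real) \<Rightarrow> bool" where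
  "bvp_solution f n \<alpha> \<beta> \<eta> u \<longleftrightarrow>
     Ck01 4 u \<and>
     (\<forall>t\<in>{0<..<1}. 0 \<le> u t \<and> (deriv01 ^^ 4) u t + f t (u t) = 0) \<and>
     deriv01 u 0 = 0 \<and> deriv01 u 1 = 0 \<and> (deriv01 ^^ 2) u 0 = 0 \<and>
     u 0 = \<alpha> * integral {0..1} u + (\<Sum>i=1..n. \<beta> i * u (\<eta> i))"

definition positive_bvp_solution ::
  "(real \<Rightarrow> real \<Rightarrow> real) \<Rightarrow> nat \<Rightarrow> real \<Rightarrow> (nat \<Rightarrow> real) \<Rightarrow> (nat \<Rightarrow> real) \<Rightarrow> (real \<Rightarrow> real) \<Rightarrow> bool" where
  "positive_bvp_solution f n \<alpha> \<beta> \<eta> u \<longleftrightarrow>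
     bvp_solution f n \<alpha> \<beta> \<eta> u \<and> (\<forall>t\<in>{0<..<1}. 0 < u t)"

end

theory Submission
  imports Defs "HOL-Complex_Analysis.Great_Picard"
begin

text \<open>
  Integrating the differential equation against the Green function turns the boundary value problem
  into \<open>u = T u\<close> with \<open>T u t\<close> the integral of \<open>\<kappa> t s * f s (u s)\<close>. The kernel \<open>\<kappa>\<close> is
  \<open>green t s\<close> plus a nonnegative function of \<open>s\<close> alone that carries the nonlocal condition
  at \<open>0\<close>, and it satisfies \<open>t^3 * \<kappa> 1 s \<le> \<kappa> t s \<le> \<kappa> 1 s\<close>
  (\<open>nonlocal_green_bounds\<close>). So every \<open>T u\<close> lies in the cone
  \<open>t^3 * u 1 \<le> u t \<le> u 1\<close>, on which the sup norm is the value \<open>u 1\<close>.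

  Sublinearity of \<open>f\<close> at \<open>0\<close> and at infinity gives radii \<open>a < \<rho>\<^sub>2 < b\<close> such that \<open>T u 1 < u 1\<close>
  whenever \<open>u 1 = a\<close> or \<open>u 1 = b\<close>. When \<open>u 1 = \<rho>\<^sub>2\<close> the lower bound on \<open>f\<close> over
  \<open>[\<theta>, 1 - \<theta>]\<close> gives \<open>T u 1 > \<rho>\<^sub>2\<close>. The inequality is strict because \<open>\<Psi>\<close> is
  strictly below the integral of \<open>\<kappa> 1\<close> over that interval (\<open>Psi_pos_less_integral\<close>): the factor
  \<open>\<theta>^6 * (1 - 2\<theta>)^2\<close> is less than \<open>1/4\<close>. A fixed point is then found in each of the two
  shells \<open>a < u 1 < \<rho>\<^sub>2\<close> and \<open>\<rho>\<^sub>2 < u 1 < b\<close>, and strictness separates the norms.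

  The fixed point theorem for shells (\<open>cone_shell_fixed_point\<close>) is Krasnoselskii's theorem for
  cones. Because the norm is the linear functional \<open>u 1\<close> on the cone, it follows directly
  from Schauder's theorem: normalise the direction of \<open>T u\<close> and move the radius from \<open>r\<close> to
  \<open>r + (T u 1 - r)\<close> if \<open>T\<close> expands at the inner boundary and contracts at the outer one,
  to \<open>r - (T u 1 - r)\<close> in the opposite case. In both cases the
  radius moves inwards at the two ends of the shell, so it can only rest where
  \<open>T u 1 = u 1\<close>. Schauder's theorem on \<open>C[0,1]\<close> (\<open>schauder_unit_interval\<close>) comes
  from Brouwer's theorem for the coefficients of Bernstein polynomials of degree \<open>N\<close>, where \<open>N\<close>
  tends to infinity, and the theorem of Arzela and Ascoli.
\<close>

section \<open>Brouwer's theorem for cubes of arbitrary finite dimension\<close>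

text \<open>
  Kuhn's combinatorial lemma on the grid of mesh \<open>b / Suc p\<close>. A grid point is labelled in
  coordinate \<open>i\<close> according to whether \<open>F\<close> moves that coordinate up or down; a cell in which each
  coordinate shows both labels almost contains a fixed point.
  The dimension \<open>n\<close> is a number and not a type, since it has to grow in the application.
\<close>

lemma kuhn_almost_fixed_point:
  fixes F :: "(nat \<Rightarrow> real) \<Rightarrow> nat \<Rightarrow> real"
  assumes "0 < b"
    and maps: "\<And>x i. \<lbrakk>\<forall>i<n. x i \<in> {0..b}; i < n\<rbrakk> \<Longrightarrow> F x i \<in> {0..b}"
  shows "\<exists>x. (\<forall>i<n. x i \<in> {0..b}) \<and>
    (\<forall>i<n. \<exists>y z. (\<forall>j<n. y j \<in> {0..b} \<and> \<bar>y j - x j\<bar> \<le> b / Suc p) \<and> y i \<le> F y i \<and>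
                  (\<forall>j<n. z j \<in> {0..b} \<and> \<bar>z j - x j\<bar> \<le> b / Suc p) \<and> F z i \<le> z i)"
proof -
  \<comment> \<open>The clause \<open>c i \<noteq> Suc p\<close> forces label \<open>1\<close> on the upper faces even where \<open>F\<close> fixes the coordinate, as Kuhn's lemma requires.\<close>
  define P where "P c = (\<lambda>i::nat. b * real (c i) / Suc p)" for c :: "nat \<Rightarrow> nat"
  define label where "label c i = (if c i \<noteq> Suc p \<and> P c i \<le> F (P c) i then 0 else 1::nat)" for c i
  have P_cube: "P c i \<in> {0..b}" if "c i \<le> Suc p" for c i
    using \<open>0 < b\<close> that
    by (auto simp: P_def divide_simps simp del: of_nat_Suc)
  have F_cube: "F (P c) i \<in> {0..b}" if "\<forall>i<n. c i \<le> Suc p" "i < n" for c i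
    using maps[of "P c" i] P_cube that by blast
  have P_close: "\<bar>P c i - P q i\<bar> \<le> b / Suc p" if "q i \<le> c i" "c i \<le> q i + 1" for c q i
  proof -
    have "P c i - P q i = b * (real (c i) - real (q i)) / Suc p"
      by (simp add: P_def diff_divide_distrib right_diff_distrib)
    moreover have "\<bar>real (c i) - real (q i)\<bar> \<le> 1"
      using that by linarith
    ultimately show ?thesis
      using \<open>0 < b\<close> mult_left_mono[of "\<bar>real (c i) - real (q i)\<bar>" 1 b]
      by (simp add: abs_mult divide_right_mono del: of_nat_Suc)
  qed
  have "P c i \<le> F (P c) i" if "\<forall>i<n. c i \<le> Suc p" "i < n" "c i = 0" for c i
    using F_cube[OF that(1,2)] that(3) by (simp add: P_def)
  then have zero: "\<forall>c. (\<forall>i<n. c i \<le> Suc p) \<longrightarrow> (\<forall>i<n. c i = 0 \<longrightarrow> label c i = 0)"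
    by (simp add: label_def)
  obtain q where q: "\<forall>i<n. q i < Suc p"
    and rs: "\<forall>i<n. \<exists>r s. (\<forall>j<n. q j \<le> r j \<and> r j \<le> q j + 1) \<and>
                         (\<forall>j<n. q j \<le> s j \<and> s j \<le> q j + 1) \<and> label r i \<noteq> label s i"
    by (rule kuhn_lemma[OF _ _ zero]) (auto simp: label_def)
  have label0: "P c i \<le> F (P c) i" if "label c i = 0" for c i
    using that by (auto simp: label_def split: if_splits)
  have label1: "F (P c) i \<le> P c i" if "label c i \<noteq> 0" "\<forall>i<n. c i \<le> Suc p" "i < n" for c i
  proof (cases "c i = Suc p")
    case True
    then have "P c i = b" by (simp add: P_def del: of_nat_Suc)
    then show ?thesis using F_cube[OF that(2,3)] by simp
  next
    case False
    then show ?thesis using that(1) by (auto simp: label_def split: if_splits)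
  qed
  show ?thesis
  proof (rule exI[of _ "P q"], intro conjI allI impI)
    fix i assume "i < n"
    show "P q i \<in> {0..b}" using q \<open>i < n\<close> P_cube by (simp add: less_imp_le)
    obtain r s where rs': "\<forall>j<n. q j \<le> r j \<and> r j \<le> q j + 1" "\<forall>j<n. q j \<le> s j \<and> s j \<le> q j + 1"
      "label r i \<noteq> label s i"
      using rs \<open>i < n\<close> by blast
    have le: "\<forall>j<n. r j \<le> Suc p" "\<forall>j<n. s j \<le> Suc p"
      using rs'(1,2) q by force+
    have near: "\<forall>j<n. P c j \<in> {0..b} \<and> \<bar>P c j - P q j\<bar> \<le> b / Suc p"
      if "c = r \<or> c = s" for c
      using that rs'(1,2) le P_cube P_close by blast
    show "\<exists>y z. (\<forall>j<n. y j \<in> {0..b} \<and> \<bar>y j - P q j\<bar> \<le> b / Suc p) \<and> y i \<le> F y i \<and>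
                (\<forall>j<n. z j \<in> {0..b} \<and> \<bar>z j - P q j\<bar> \<le> b / Suc p) \<and> F z i \<le> z i"
    proof (cases "label r i = 0")
      case True
      then show ?thesis
        using near label0[of r i] label1[of s i] rs'(3) le \<open>i < n\<close>
        by (intro exI[of _ "P r"] exI[of _ "P s"]) auto
    next
      case False
      then have "label s i = 0" using rs'(3) by (auto simp: label_def split: if_splits)
      with False show ?thesis
        using near label0[of s i] label1[of r i] le \<open>i < n\<close>
        by (intro exI[of _ "P s"] exI[of _ "P r"]) auto
    qed
  qed
qed

text \<open>
  Brouwer's theorem with continuity stated for coordinatewise convergent sequences, which only sees
  the first \<open>n\<close> coordinates. The almost fixed points of finer and finer grids
  have a limit point \<open>x\<close>; the two neighbours of opposite labels converge to \<open>x\<close> as well and give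
  \<open>x i \<le> F x i\<close> and \<open>F x i \<le> x i\<close>.
\<close>

lemma brouwer_cube_nat:
  fixes F :: "(nat \<Rightarrow> real) \<Rightarrow> nat \<Rightarrow> real"
  assumes "0 < b"
    and maps: "\<And>x i. \<lbrakk>\<forall>i<n. x i \<in> {0..b}; i < n\<rbrakk> \<Longrightarrow> F x i \<in> {0..b}"
    and cont: "\<And>X x i. \<lbrakk>\<And>k. \<forall>i<n. X k i \<in> {0..b}; \<forall>i<n. x i \<in> {0..b};
                 \<forall>i<n. (\<lambda>k. X k i) \<longlonglongrightarrow> x i; i < n\<rbrakk> \<Longrightarrow> (\<lambda>k. F (X k) i) \<longlonglongrightarrow> F x i"
  obtains x where "\<forall>i<n. x i \<in> {0..b}" "\<forall>i<n. F x i = x i"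
proof -
  have "\<forall>p::nat. \<exists>x. (\<forall>i<n. x i \<in> {0..b}) \<and>
    (\<forall>i<n. \<exists>y z. (\<forall>j<n. y j \<in> {0..b} \<and> \<bar>y j - x j\<bar> \<le> b / Suc p) \<and> y i \<le> F y i \<and>
                  (\<forall>j<n. z j \<in> {0..b} \<and> \<bar>z j - x j\<bar> \<le> b / Suc p) \<and> F z i \<le> z i)"
    using kuhn_almost_fixed_point[of b n F, OF \<open>0 < b\<close> maps] by blast
  then obtain Q where Q: "\<And>p i. i < n \<Longrightarrow> Q p i \<in> {0..b}"
    and yz: "\<And>p i. i < n \<Longrightarrow> \<exists>y z.
      (\<forall>j<n. y j \<in> {0..b} \<and> \<bar>y j - Q p j\<bar> \<le> b / Suc p) \<and> y i \<le> F y i \<and>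
      (\<forall>j<n. z j \<in> {0..b} \<and> \<bar>z j - Q p j\<bar> \<le> b / Suc p) \<and> F z i \<le> z i"
    by metis
  obtain k where "strict_mono k" and "\<And>i. i < n \<Longrightarrow> \<exists>l. (\<lambda>m. Q (k m) i) \<longlonglongrightarrow> l"
    by (rule function_convergent_subsequence[of "{..<n}" Q b]) (use Q in auto)
  then obtain x where x: "\<And>i. i < n \<Longrightarrow> (\<lambda>m. Q (k m) i) \<longlonglongrightarrow> x i"
    by metis
  have x_cube: "\<forall>i<n. x i \<in> {0..b}"
    using Q closed_sequentially[of "{0..b}" "\<lambda>m. Q (k m) i" "x i" for i] x by blast
  have small: "(\<lambda>m. b / real (Suc (k m))) \<longlonglongrightarrow> 0"
    using LIMSEQ_subseq_LIMSEQ[OF lim_const_over_n[of b, THEN LIMSEQ_Suc] \<open>strict_mono k\<close>]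
    by (simp add: o_def)
  have F_lim: "(\<lambda>m. F (Y m) i) \<longlonglongrightarrow> F x i" "(\<lambda>m. Y m i) \<longlonglongrightarrow> x i"
    if Y: "\<And>m j. j < n \<Longrightarrow> Y m j \<in> {0..b} \<and> \<bar>Y m j - Q (k m) j\<bar> \<le> b / Suc (k m)" and "i < n" for Y i
  proof -
    have lim: "(\<lambda>m. Y m j) \<longlonglongrightarrow> x j" if "j < n" for j
    proof -
      have "(\<lambda>m. Y m j - Q (k m) j) \<longlonglongrightarrow> 0"
        by (rule Lim_null_comparison[OF _ small]) (use Y that in auto)
      from tendsto_add[OF this x[OF that]] show ?thesis by simp
    qed
    then show "(\<lambda>m. Y m i) \<longlonglongrightarrow> x i" using \<open>i < n\<close> .
    show "(\<lambda>m. F (Y m) i) \<longlonglongrightarrow> F x i"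
      by (rule cont) (use Y x_cube lim \<open>i < n\<close> in auto)
  qed
  have "F x i = x i" if i: "i < n" for i
  proof -
    obtain Y Z where
      Y: "\<And>m j. j < n \<Longrightarrow> Y m j \<in> {0..b} \<and> \<bar>Y m j - Q (k m) j\<bar> \<le> b / Suc (k m)"
        "\<And>m. Y m i \<le> F (Y m) i" and
      Z: "\<And>m j. j < n \<Longrightarrow> Z m j \<in> {0..b} \<and> \<bar>Z m j - Q (k m) j\<bar> \<le> b / Suc (k m)"
        "\<And>m. F (Z m) i \<le> Z m i"
      using yz[OF i, of "k _"] by metis
    have "x i \<le> F x i"
      by (rule LIMSEQ_le[OF F_lim(2)[OF Y(1) that] F_lim(1)[OF Y(1) that]]) (use Y(2) in auto)
    moreover have "F x i \<le> x i"
      by (rule LIMSEQ_le[OF F_lim(1)[OF Z(1) that] F_lim(2)[OF Z(1) that]]) (use Z(2) in auto)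
    ultimately show ?thesis by simp
  qed
  with x_cube show ?thesis using that by blast
qed

section \<open>Schauder's theorem for continuous functions on the unit interval\<close>

text \<open>
  Bernstein polynomials are a partition of unity, so a bound on coefficients is a bound on the
  polynomial. This makes the passage from coefficients to functions nonexpansive.
\<close>

lemma Bernstein_combination_abs_le:
  fixes c :: "nat \<Rightarrow> real"
  assumes "\<And>k. k \<le> n \<Longrightarrow> \<bar>c k\<bar> \<le> e" "t \<in> {0..1}"
  shows "\<bar>\<Sum>k\<le>n. c k * Bernstein n k t\<bar> \<le> e"
proof -
  have "\<bar>\<Sum>k\<le>n. c k * Bernstein n k t\<bar> \<le> (\<Sum>k\<le>n. e * Bernstein n k t)"
    by (rule order_trans[OF sum_abs])
       (use assms in \<open>auto intro!: sum_mono mult_right_mono simp: abs_mult Bernstein_nonneg\<close>)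
  then show ?thesis by (simp flip: sum_distrib_left)
qed

text \<open>
  For each \<open>N\<close>, Brouwer's theorem gives coefficients that \<open>\<Phi>\<close>, applied to their Bernstein
  polynomial \<open>w N\<close> and sampled at the nodes \<open>k / N\<close>, reproduces. Hence \<open>w N\<close> is the Bernstein
  approximation of \<open>V N = \<Phi> (w N)\<close>. The functions \<open>V N\<close> are equicontinuous, and if a subsequence
  tends uniformly to \<open>u\<close>, then so does the corresponding subsequence of \<open>w N\<close>, whence \<open>\<Phi> u = u\<close>.
\<close>

lemma schauder_unit_interval:
  fixes \<Phi> :: "(real \<Rightarrow> real) \<Rightarrow> real \<Rightarrow> real"
  assumes "0 < b"
  defines "D \<equiv> {u. continuous_on {0..1} u \<and> (\<forall>t\<in>{0..1}. u t \<in> {0..b})}"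
  assumes maps: "\<And>u t. \<lbrakk>u \<in> D; t \<in> {0..1}\<rbrakk> \<Longrightarrow> \<Phi> u t \<in> {0..b}"
    and equicont: "\<And>t e. \<lbrakk>t \<in> {0..1}; 0 < e\<rbrakk> \<Longrightarrow>
          \<exists>d>0. \<forall>u\<in>D. \<forall>s\<in>{0..1}. \<bar>t - s\<bar> < d \<longrightarrow> \<bar>\<Phi> u t - \<Phi> u s\<bar> < e"
    and cont: "\<And>v u t. \<lbrakk>\<And>m. v m \<in> D; u \<in> D; uniform_limit {0..1} v u sequentially; t \<in> {0..1}\<rbrakk>
          \<Longrightarrow> (\<lambda>m. \<Phi> (v m) t) \<longlonglongrightarrow> \<Phi> u t"
  obtains u where "u \<in> D" "\<And>t. t \<in> {0..1} \<Longrightarrow> \<Phi> u t = u t"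
proof -
  define B where "B N x t = (\<Sum>k\<le>N. x k * Bernstein N k t)" for N and x :: "nat \<Rightarrow> real" and t
  have B_D: "B N x \<in> D" if "\<forall>k<Suc N. x k \<in> {0..b}" for N x
  proof -
    have "continuous_on {0..1} (B N x)"
      unfolding B_def Bernstein_def by (intro continuous_intros)
    moreover have "B N x t \<in> {0..b}" if "t \<in> {0..1}" for t
    proof -
      have "0 \<le> B N x t"
        unfolding B_def using \<open>\<forall>k<Suc N. x k \<in> {0..b}\<close> that
        by (auto intro!: sum_nonneg mult_nonneg_nonneg Bernstein_nonneg simp: less_Suc_eq_le)
      moreover have "\<bar>B N x t\<bar> \<le> b"
        unfolding B_def using \<open>\<forall>k<Suc N. x k \<in> {0..b}\<close> that
        by (intro Bernstein_combination_abs_le) (auto simp: less_Suc_eq_le)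
      ultimately show ?thesis by auto
    qed
    ultimately show ?thesis by (simp add: D_def)
  qed
  have "\<exists>x. (\<forall>k<Suc N. x k \<in> {0..b}) \<and> (\<forall>k<Suc N. \<Phi> (B N x) (k / N) = x k)" for N
  proof -
    have node: "real k / real N \<in> {0..1}" if "k < Suc N" for k
      using that by (auto simp: divide_simps)
    have "(\<lambda>m. \<Phi> (B N (X m)) (k / N)) \<longlonglongrightarrow> \<Phi> (B N x) (k / N)"
      if X: "\<And>m. \<forall>i<Suc N. X m i \<in> {0..b}" "\<forall>i<Suc N. x i \<in> {0..b}"
        "\<forall>i<Suc N. (\<lambda>m. X m i) \<longlonglongrightarrow> x i" and "k < Suc N" for X x k
    proof (rule cont)
      show "B N (X m) \<in> D" for m using B_D X(1) by blast
      show "B N x \<in> D" using B_D X(2) by blast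
      show "uniform_limit {0..1} (\<lambda>m. B N (X m)) (B N x) sequentially"
      proof (rule uniform_limitI)
        fix e :: real assume "0 < e"
        have "\<forall>\<^sub>F m in sequentially. \<forall>i\<in>{..N}. dist (X m i) (x i) < e / 2"
          using X(3) \<open>0 < e\<close>
          by (intro eventually_ball_finite) (auto dest!: tendstoD[of _ _ _ "e/2"] simp: less_Suc_eq_le)
        then show "\<forall>\<^sub>F m in sequentially. \<forall>t\<in>{0..1}. dist (B N (X m) t) (B N x t) < e"
        proof eventually_elim
          case (elim m)
          have "\<bar>B N (X m) t - B N x t\<bar> \<le> e / 2" if "t \<in> {0..1}" for t
          proof -
            have "B N (X m) t - B N x t = (\<Sum>k\<le>N. (X m k - x k) * Bernstein N k t)"
              by (simp add: B_def left_diff_distrib sum_subtractf)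
            then show ?thesis
              using Bernstein_combination_abs_le[of N "\<lambda>k. X m k - x k" "e/2" t] elim that
              by (auto simp: dist_real_def less_imp_le)
          qed
          then show ?case using \<open>0 < e\<close> by (force simp: dist_real_def)
        qed
      qed
    qed (use node that in auto)
    then obtain x where "\<forall>k<Suc N. x k \<in> {0..b}" "\<forall>k<Suc N. \<Phi> (B N x) (k / N) = x k"
      using brouwer_cube_nat[of b "Suc N" "\<lambda>x k. \<Phi> (B N x) (k / N)"] \<open>0 < b\<close> maps[OF B_D node]
      by (smt (verit))
    then show ?thesis by blast
  qed
  then obtain x where x: "\<And>N k. k \<le> N \<Longrightarrow> x N k \<in> {0..b}"
      "\<And>N k. k \<le> N \<Longrightarrow> \<Phi> (B N (x N)) (k / N) = x N k"
    by (metis less_Suc_eq_le)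
  define w where "w N = B N (x N)" for N
  define V where "V N = \<Phi> (w N)" for N
  have w_D: "w N \<in> D" for N
    using B_D x(1) by (simp add: w_def less_Suc_eq_le)
  have V: "V N t \<in> {0..b}" if "t \<in> {0..1}" for N t
    using maps[OF w_D that] by (simp add: V_def)
  have V_bound: "norm (V N t) \<le> b" if "t \<in> {0..1}" for N t
    using V[OF that, of N] by simp
  have V_equicont: "\<exists>d. 0 < d \<and> (\<forall>N s. s \<in> {0..1} \<and> norm (t - s) < d \<longrightarrow> norm (V N t - V N s) < e)"
    if te: "t \<in> {0..1}" "0 < e" for t e
    using equicont[OF te] w_D unfolding V_def real_norm_def by blast
  obtain u and k :: "nat \<Rightarrow> nat" where "continuous_on {0..1} u" "strict_mono k" and
    lim: "\<And>e. 0 < e \<Longrightarrow> \<exists>N. \<forall>m t. m \<ge> N \<and> t \<in> {0..1} \<longrightarrow> norm (V (k m) t - u t) < e"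
    using Arzela_Ascoli[of "{0..1}" V b, OF compact_Icc V_bound V_equicont] by metis
  have V_lim: "(\<lambda>m. V (k m) t) \<longlonglongrightarrow> u t" if "t \<in> {0..1}" for t
    unfolding LIMSEQ_iff using lim that by meson
  have "u \<in> D"
    unfolding D_def using \<open>continuous_on {0..1} u\<close> V_lim V
      closed_sequentially[of "{0..b}" "\<lambda>m. V (k m) t" "u t" for t] by blast
  have "uniform_limit {0..1} (\<lambda>m. w (k m)) u sequentially"
  proof (rule uniform_limitI)
    fix e :: real assume "0 < e"
    obtain N1 where N1: "\<And>m t. m \<ge> N1 \<Longrightarrow> t \<in> {0..1} \<Longrightarrow> \<bar>V (k m) t - u t\<bar> < e / 2"
      using lim[of "e/2"] \<open>0 < e\<close> by auto
    obtain N2 where N2: "\<And>n t. n \<ge> N2 \<Longrightarrow> t \<in> {0..1} \<Longrightarrow> \<bar>u t - B n (\<lambda>i. u (i / n)) t\<bar> < e / 2"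
      using Bernstein_Weierstrass[OF \<open>continuous_on {0..1} u\<close>, of "e/2"] \<open>0 < e\<close>
      by (auto simp: B_def)
    have "dist (w (k m) t) (u t) < e" if "m \<ge> max N1 N2" "t \<in> {0..1}" for m t
    proof -
      let ?n = "k m"
      have "?n \<ge> N2" using that seq_suble[OF \<open>strict_mono k\<close>, of m] by simp
      have "w ?n t - B ?n (\<lambda>i. u (i / ?n)) t
              = (\<Sum>i\<le>?n. (x ?n i - u (i / ?n)) * Bernstein ?n i t)"
        by (simp add: w_def B_def left_diff_distrib sum_subtractf)
      moreover have "\<bar>x ?n i - u (i / ?n)\<bar> \<le> e / 2" if "i \<le> ?n" for i
      proof -
        have "real i / real ?n \<in> {0..1}"
          using that by (auto simp: divide_simps)
        then show ?thesis
          using x(2)[OF that] N1[of m "i / ?n"] \<open>m \<ge> max N1 N2\<close> by (simp add: V_def w_def)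
      qed
      ultimately have "\<bar>w ?n t - B ?n (\<lambda>i. u (i / ?n)) t\<bar> \<le> e / 2"
        using Bernstein_combination_abs_le[of ?n "\<lambda>i. x ?n i - u (i / ?n)" "e/2" t] that by simp
      then show ?thesis
        using N2[OF \<open>?n \<ge> N2\<close> that(2)] unfolding dist_real_def
        by (smt (verit) field_sum_of_halves)
    qed
    then show "\<forall>\<^sub>F m in sequentially. \<forall>t\<in>{0..1}. dist (w (k m) t) (u t) < e"
      unfolding eventually_sequentially by blast
  qed
  then have "(\<lambda>m. V (k m) t) \<longlonglongrightarrow> \<Phi> u t" if "t \<in> {0..1}" for t
    unfolding V_def using cont[of "\<lambda>m. w (k m)" u t] w_D \<open>u \<in> D\<close> that by blast
  then have "\<Phi> u t = u t" if "t \<in> {0..1}" for t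
    using V_lim that LIMSEQ_unique by blast
  with \<open>u \<in> D\<close> show ?thesis using that by blast
qed

section \<open>Fixed points in a shell of a cone\<close>

lemma abs_max_diff_le: "\<lbrakk>\<bar>w - y\<bar> \<le> e; \<bar>x - z\<bar> \<le> e\<rbrakk> \<Longrightarrow> \<bar>max w x - max y z\<bar> \<le> e"
  for w x y z e :: real
  by linarith

lemma abs_min_diff_le: "\<lbrakk>\<bar>w - y\<bar> \<le> e; \<bar>x - z\<bar> \<le> e\<rbrakk> \<Longrightarrow> \<bar>min w x - min y z\<bar> \<le> e"
  for w x y z e :: real
  by linarith

text \<open>
  Krasnoselskii's theorem, in its compressive form for \<open>\<sigma> > 0\<close> and its expansive form for \<open>\<sigma> < 0\<close>.
  The set \<open>K\<close> is a shell of the cone of functions that dominate \<open>q\<close> times their value at \<open>1\<close> and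
  attain their maximum there. The map \<open>R\<close> retracts all continuous functions onto the shell,
  \<open>r\<close> is the radius and \<open>\<phi>\<close> the radius of the image; \<open>\<Phi>\<close> returns the normalised
  image with the new radius \<open>r'\<close>.
\<close>

lemma cone_shell_fixed_point:
  fixes T :: "(real \<Rightarrow> real) \<Rightarrow> real \<Rightarrow> real" and q :: "real \<Rightarrow> real" and a b \<sigma> :: real
  assumes ab: "0 < a" "a < b"
    and q: "continuous_on {0..1} q" "\<And>t. t \<in> {0..1} \<Longrightarrow> q t \<in> {0..1}" "q 1 = 1"
  defines "K \<equiv> {u. continuous_on {0..1} u \<and> (\<forall>t\<in>{0..1}. q t * u 1 \<le> u t \<and> u t \<le> u 1) \<and> u 1 \<in> {a..b}}"
  assumes cone: "\<And>u t. \<lbrakk>u \<in> K; t \<in> {0..1}\<rbrakk> \<Longrightarrow> 0 \<le> T u t \<and> q t * T u 1 \<le> T u t \<and> T u t \<le> T u 1"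
    and equicont: "\<And>t e. \<lbrakk>t \<in> {0..1}; 0 < e\<rbrakk> \<Longrightarrow>
          \<exists>d>0. \<forall>u\<in>K. \<forall>s\<in>{0..1}. \<bar>t - s\<bar> < d \<longrightarrow> \<bar>T u t - T u s\<bar> < e"
    and cont: "\<And>v u t. \<lbrakk>\<And>m. v m \<in> K; u \<in> K; uniform_limit {0..1} v u sequentially; t \<in> {0..1}\<rbrakk>
          \<Longrightarrow> (\<lambda>m. T (v m) t) \<longlonglongrightarrow> T u t"
    and inner: "\<And>u. \<lbrakk>u \<in> K; u 1 = a\<rbrakk> \<Longrightarrow> 0 < \<sigma> * (T u 1 - a)"
    and outer: "\<And>u. \<lbrakk>u \<in> K; u 1 = b\<rbrakk> \<Longrightarrow> \<sigma> * (T u 1 - b) < 0"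
  obtains u where "u \<in> K" "a < u 1" "u 1 < b" "\<And>t. t \<in> {0..1} \<Longrightarrow> T u t = u t"
proof -
  define R where "R u t = (let r = max a (min b (u 1)) in max (q t * r) (min r (u t)))"
    for u :: "real \<Rightarrow> real" and t
  have R1: "R u 1 = max a (min b (u 1))" for u
    by (simp add: R_def Let_def q(3))
  have R_K: "R u \<in> K" if "continuous_on {0..1} u" for u
  proof -
    define r where "r = max a (min b (u 1))"
    have R: "R u = (\<lambda>t. max (q t * r) (min r (u t)))"
      by (simp add: fun_eq_iff R_def r_def Let_def)
    have "r \<in> {a..b}" using ab by (auto simp: r_def)
    then have "q t * r \<le> r" if "t \<in> {0..1}" for t
      using q(2)[OF that] ab by (simp add: mult_le_cancel_right1)
    moreover have "continuous_on {0..1} (R u)"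
      unfolding R by (intro continuous_intros q that)
    ultimately show ?thesis
      using \<open>r \<in> {a..b}\<close> R1[of u] by (auto simp: K_def R r_def[symmetric])
  qed
  have R_id: "R u t = u t" if "u \<in> K" "t \<in> {0..1}" for u t
    using that by (auto simp: R_def K_def Let_def)
  have R_dist: "\<bar>R v t - R u t\<bar> \<le> max \<bar>v 1 - u 1\<bar> \<bar>v t - u t\<bar>" if "t \<in> {0..1}" for u v t
  proof -
    let ?r = "max a (min b (u 1))" and ?s = "max a (min b (v 1))"
    define e where "e = max \<bar>v 1 - u 1\<bar> \<bar>v t - u t\<bar>"
    have e: "0 \<le> e" "\<bar>v 1 - u 1\<bar> \<le> e" "\<bar>v t - u t\<bar> \<le> e" by (auto simp: e_def)
    have rs: "\<bar>?s - ?r\<bar> \<le> e"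
      by (intro abs_max_diff_le abs_min_diff_le) (use e in auto)
    have "\<bar>q t * ?s - q t * ?r\<bar> \<le> \<bar>?s - ?r\<bar>"
      using q(2)[OF that] by (simp add: abs_mult mult_left_le_one_le flip: right_diff_distrib)
    then have "\<bar>q t * ?s - q t * ?r\<bar> \<le> e" using rs by (rule order_trans)
    then show ?thesis
      unfolding R_def Let_def e_def[symmetric]
      by (intro abs_max_diff_le abs_min_diff_le rs e)
  qed
  define \<phi> where "\<phi> u = T (R u) 1" for u
  define r where "r u = max a (min b (u 1))" for u :: "real \<Rightarrow> real"
  \<comment> \<open>Adding \<open>N\<close> to the image before normalising keeps the denominator \<open>\<phi> u + N u = max (\<phi> u) (r u)\<close> away from \<open>0\<close> where \<open>T\<close> might vanish; it disappears where \<open>\<phi> u = r u\<close>.\<close>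
  define N where "N u = max 0 (r u - \<phi> u)" for u
  define r' where "r' u = max a (min b (r u + \<sigma> * (\<phi> u - r u)))" for u
  define \<Phi> where "\<Phi> u t = r' u * ((T (R u) t + N u) / (\<phi> u + N u))" for u t
  have r'_ab: "r' u \<in> {a..b}" for u using ab by (auto simp: r'_def)
  have M: "a \<le> \<phi> u + N u" for u using ab by (auto simp: N_def r_def)
  obtain u where u: "continuous_on {0..1} u" "\<And>t. t \<in> {0..1} \<Longrightarrow> \<Phi> u t = u t"
  proof (rule schauder_unit_interval[of b \<Phi>])
    show "0 < b" using ab by simp
  next
    fix u :: "real \<Rightarrow> real" and t :: real
    assume "u \<in> {u. continuous_on {0..1} u \<and> (\<forall>t\<in>{0..1}. u t \<in> {0..b})}" and t: "t \<in> {0..1}"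
    then have T: "0 \<le> T (R u) t" "T (R u) t \<le> \<phi> u"
      using cone[OF R_K t, of u] by (auto simp: \<phi>_def)
    have "0 \<le> N u" by (simp add: N_def)
    with T M[of u] ab have "(T (R u) t + N u) / (\<phi> u + N u) \<in> {0..1}"
      by (simp add: divide_simps)
    then have x: "0 \<le> (T (R u) t + N u) / (\<phi> u + N u)" "(T (R u) t + N u) / (\<phi> u + N u) \<le> 1"
      by auto
    have "0 \<le> r' u" "r' u \<le> b" using r'_ab[of u] ab by auto
    then show "\<Phi> u t \<in> {0..b}"
      using mult_mono[OF \<open>r' u \<le> b\<close> x(2)] mult_nonneg_nonneg[OF _ x(1), of "r' u"] ab x(1)
      unfolding \<Phi>_def atLeastAtMost_iff mult_1_right by linarith
  next
    fix t e :: real assume t: "t \<in> {0..1}" and "0 < e"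
    then obtain d where "d > 0"
      and d: "\<And>u s. \<lbrakk>u \<in> K; s \<in> {0..1}; \<bar>t - s\<bar> < d\<rbrakk> \<Longrightarrow> \<bar>T u t - T u s\<bar> < e * a / b"
      using equicont[of t "e * a / b"] ab by auto
    have "\<bar>\<Phi> u t - \<Phi> u s\<bar> < e" if "continuous_on {0..1} u" "s \<in> {0..1}" "\<bar>t - s\<bar> < d" for u s
    proof -
      have "\<bar>\<Phi> u t - \<Phi> u s\<bar> = r' u / (\<phi> u + N u) * \<bar>T (R u) t - T (R u) s\<bar>"
        using r'_ab[of u] M[of u] ab
        by (simp add: \<Phi>_def abs_mult flip: right_diff_distrib diff_divide_distrib)
      also have "\<dots> \<le> b / a * \<bar>T (R u) t - T (R u) s\<bar>"
        using r'_ab[of u] M[of u] ab by (intro mult_right_mono frac_le) auto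
      also have "\<dots> < b / a * (e * a / b)"
        using d[OF R_K that(2,3)] that(1) ab by (intro mult_strict_left_mono) auto
      finally show ?thesis using ab by simp
    qed
    with \<open>d > 0\<close> show "\<exists>d>0. \<forall>u\<in>{u. continuous_on {0..1} u \<and> (\<forall>t\<in>{0..1}. u t \<in> {0..b})}.
        \<forall>s\<in>{0..1}. \<bar>t - s\<bar> < d \<longrightarrow> \<bar>\<Phi> u t - \<Phi> u s\<bar> < e"
      by blast
  next
    fix v :: "nat \<Rightarrow> real \<Rightarrow> real" and u :: "real \<Rightarrow> real" and t :: real
    assume v: "\<And>m. v m \<in> {u. continuous_on {0..1} u \<and> (\<forall>t\<in>{0..1}. u t \<in> {0..b})}"
      and u: "u \<in> {u. continuous_on {0..1} u \<and> (\<forall>t\<in>{0..1}. u t \<in> {0..b})}"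
      and lim: "uniform_limit {0..1} v u sequentially" and t: "t \<in> {0..1}"
    have v1: "(\<lambda>m. v m 1) \<longlonglongrightarrow> u 1"
      using tendsto_uniform_limitI[OF lim, of 1] by simp
    have "uniform_limit {0..1} (\<lambda>m. R (v m)) (R u) sequentially"
    proof (rule uniform_limitI)
      fix e :: real assume "0 < e"
      from uniform_limitD[OF lim this] show "\<forall>\<^sub>F m in sequentially. \<forall>t\<in>{0..1}. dist (R (v m) t) (R u t) < e"
      proof eventually_elim
        case (elim m)
        have "\<bar>v m 1 - u 1\<bar> < e" using elim[rule_format, of 1] by (simp add: dist_real_def)
        then have "\<bar>R (v m) t - R u t\<bar> < e" if "t \<in> {0..1}" for t
          using R_dist[OF that, of "v m" u] elim[rule_format, OF that] unfolding dist_real_def by linarith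
        then show ?case by (simp add: dist_real_def)
      qed
    qed
    then have TR: "(\<lambda>m. T (R (v m)) t) \<longlonglongrightarrow> T (R u) t" if "t \<in> {0..1}" for t
      using cont[OF R_K R_K _ that] u v by blast
    have \<phi>: "(\<lambda>m. \<phi> (v m)) \<longlonglongrightarrow> \<phi> u"
      unfolding \<phi>_def by (rule TR) simp
    have r: "(\<lambda>m. r (v m)) \<longlonglongrightarrow> r u"
      unfolding r_def by (intro tendsto_intros v1)
    have N: "(\<lambda>m. N (v m)) \<longlonglongrightarrow> N u"
      unfolding N_def by (intro tendsto_intros r \<phi>)
    show "(\<lambda>m. \<Phi> (v m) t) \<longlonglongrightarrow> \<Phi> u t"
      unfolding \<Phi>_def r'_def using M[of u] ab by (intro tendsto_intros r \<phi> N TR t) auto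
  qed (simp, blast)
  have RK: "R u \<in> K" by (rule R_K[OF u(1)])
  have Ru1: "R u 1 = r u" by (simp add: R1 r_def)
  have "u 1 = r' u"
    using u(2)[of 1] M[of u] ab by (simp add: \<Phi>_def \<phi>_def[symmetric])
  then have r_eq: "r u = r' u"
    using r'_ab[of u] by (auto simp: r_def)
  \<comment> \<open>At a fixed point of \<open>\<Phi>\<close> the radius is unchanged, and at either end of the shell the clamped displacement \<open>x\<close> would move it inwards.\<close>
  define x where "x = \<sigma> * (\<phi> u - r u)"
  have x: "r u = max a (min b (r u + x))"
    using r_eq by (simp add: r'_def x_def)
  have "x > 0" if "r u = a"
    using inner[OF RK] Ru1 that by (simp add: x_def \<phi>_def)
  then have "r u \<noteq> a" using x ab by linarith
  have "x < 0" if "r u = b"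
    using outer[OF RK] Ru1 that by (simp add: x_def \<phi>_def)
  then have "r u \<noteq> b" using x ab by linarith
  have r_ab: "a < r u" "r u < b"
    using \<open>r u \<noteq> a\<close> \<open>r u \<noteq> b\<close> r_eq r'_ab[of u] by auto
  then have "\<sigma> * (\<phi> u - r u) = 0"
    using x unfolding x_def by linarith
  moreover have "\<sigma> \<noteq> 0" using inner[of "\<lambda>_. a"] ab q(2) by (auto simp: K_def mult_le_cancel_right1)
  ultimately have \<phi>: "\<phi> u = r u" by simp
  then have "T (R u) t = u t" if "t \<in> {0..1}" for t
    using u(2)[OF that] r_ab ab by (simp add: \<Phi>_def N_def r_eq[symmetric])
  moreover have "u t = R u t" if "t \<in> {0..1}" for t
  proof -
    have "u 1 = r u" using \<open>u 1 = r' u\<close> r_eq by simp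
    have "T (R u) 1 = u 1" using calculation by simp
    then have "q t * u 1 \<le> u t" "u t \<le> u 1"
      using cone[OF RK that] calculation[OF that] by auto
    moreover have "max a (min b (u 1)) = u 1" using \<open>u 1 = r u\<close> r_ab by simp
    ultimately show ?thesis by (simp add: R_def Let_def)
  qed
  ultimately have "T (R u) t = R u t" if "t \<in> {0..1}" for t
    using that by simp
  then show ?thesis using that RK Ru1 r_ab by simp
qed

section \<open>Hammerstein integral equations\<close>

lemma continuous_on_superposition:
  fixes h :: "real \<Rightarrow> real \<Rightarrow> real"
  assumes "continuous_on ({0..1} \<times> X) (\<lambda>(s, x). h s x)" "continuous_on {0..1} u"
    and "\<And>s. s \<in> {0..1} \<Longrightarrow> u s \<in> X"
  shows "continuous_on {0..1} (\<lambda>s. h s (u s))"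
  using continuous_on_compose2[OF assms(1) continuous_on_Pair[OF continuous_on_id assms(2)]] assms(3)
  by (auto simp: image_subset_iff)

lemma uniform_limit_superposition:
  fixes h :: "real \<Rightarrow> real \<Rightarrow> real"
  assumes h: "continuous_on ({0..1} \<times> X) (\<lambda>(s, x). h s x)" and "compact X"
    and lim: "uniform_limit {0..1} v u sequentially"
    and X: "\<And>m s. s \<in> {0..1} \<Longrightarrow> v m s \<in> X" "\<And>s. s \<in> {0..1} \<Longrightarrow> u s \<in> X"
  shows "uniform_limit {0..1} (\<lambda>m s. h s (v m s)) (\<lambda>s. h s (u s)) sequentially"
proof (rule uniform_limitI)
  fix e :: real assume "0 < e"
  have "uniformly_continuous_on ({0..1} \<times> X) (\<lambda>(s, x). h s x)"
    using h \<open>compact X\<close> by (intro compact_uniformly_continuous compact_Times) auto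
  then obtain d where "d > 0" and d: "\<And>p p'. \<lbrakk>p \<in> {0..1} \<times> X; p' \<in> {0..1} \<times> X; dist p' p < d\<rbrakk>
      \<Longrightarrow> dist (case p' of (s, x) \<Rightarrow> h s x) (case p of (s, x) \<Rightarrow> h s x) < e"
    unfolding uniformly_continuous_on_def using \<open>0 < e\<close> by meson
  from uniform_limitD[OF lim \<open>d > 0\<close>]
  show "\<forall>\<^sub>F m in sequentially. \<forall>s\<in>{0..1}. dist (h s (v m s)) (h s (u s)) < e"
  proof eventually_elim
    case (elim m)
    show ?case
    proof
      fix s :: real assume s: "s \<in> {0..1}"
      have "dist (s, v m s) (s, u s) < d"
        using elim s by (simp add: dist_Pair_Pair)
      then show "dist (h s (v m s)) (h s (u s)) < e"
        using d[of "(s, u s)" "(s, v m s)"] X s by simp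
    qed
  qed
qed

text \<open>
  The two-sided bound on the kernel puts the range of \<open>T\<close> into the cone, whatever \<open>f \<ge> 0\<close> is.
  Equicontinuity comes from the uniform continuity of \<open>\<kappa>\<close> and the boundedness of \<open>f\<close> on
  \<open>[0,1] \<times> [0,b]\<close>.
\<close>

theorem hammerstein_fixed_point:
  fixes \<kappa> f :: "real \<Rightarrow> real \<Rightarrow> real" and q :: "real \<Rightarrow> real" and a b \<sigma> :: real
  assumes ab: "0 < a" "a < b"
    and q: "continuous_on {0..1} q" "\<And>t. t \<in> {0..1} \<Longrightarrow> q t \<in> {0..1}" "q 1 = 1"
    and \<kappa>: "continuous_on ({0..1} \<times> {0..1}) (\<lambda>(t, s). \<kappa> t s)"
      "\<And>t s. \<lbrakk>t \<in> {0..1}; s \<in> {0..1}\<rbrakk> \<Longrightarrow> 0 \<le> \<kappa> t s \<and> q t * \<kappa> 1 s \<le> \<kappa> t s \<and> \<kappa> t s \<le> \<kappa> 1 s"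
    and f: "continuous_on ({0..1} \<times> {0..}) (\<lambda>(s, x). f s x)"
      "\<And>s x. \<lbrakk>s \<in> {0..1}; 0 \<le> x\<rbrakk> \<Longrightarrow> 0 \<le> f s x"
  defines "K \<equiv> {u. continuous_on {0..1} u \<and> (\<forall>t\<in>{0..1}. q t * u 1 \<le> u t \<and> u t \<le> u 1) \<and> u 1 \<in> {a..b}}"
    and "T \<equiv> \<lambda>u t. integral {0..1} (\<lambda>s. \<kappa> t s * f s (u s))"
  assumes inner: "\<And>u. \<lbrakk>u \<in> K; u 1 = a\<rbrakk> \<Longrightarrow> 0 < \<sigma> * (T u 1 - a)"
    and outer: "\<And>u. \<lbrakk>u \<in> K; u 1 = b\<rbrakk> \<Longrightarrow> \<sigma> * (T u 1 - b) < 0"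
  obtains u where "u \<in> K" "a < u 1" "u 1 < b" "\<And>t. t \<in> {0..1} \<Longrightarrow> T u t = u t"
proof -
  have u_b: "u s \<in> {0..b}" if "u \<in> K" "s \<in> {0..1}" for u s
  proof -
    have "q s * u 1 \<le> u s" "u s \<le> u 1" "u 1 \<in> {a..b}" "0 \<le> q s"
      using that q(2)[OF that(2)] by (auto simp: K_def)
    moreover have "0 \<le> q s * u 1" using calculation ab by (intro mult_nonneg_nonneg) auto
    ultimately show ?thesis by auto
  qed
  have f_b: "continuous_on ({0..1} \<times> {0..b}) (\<lambda>(s, x). f s x)"
    by (rule continuous_on_subset[OF f(1)]) auto
  have \<kappa>_cont: "continuous_on {0..1} (\<kappa> t)" if "t \<in> {0..1}" for t
    using continuous_on_compose2[OF \<kappa>(1)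
        continuous_on_Pair[OF continuous_on_const[of _ t] continuous_on_id], of "{0..1}"] that
    by (auto simp: image_subset_iff)
  have fu_cont: "continuous_on {0..1} (\<lambda>s. f s (u s))" if "u \<in> K" for u
    by (rule continuous_on_superposition[OF f_b]) (use that u_b in \<open>auto simp: K_def\<close>)
  have int_cont: "continuous_on {0..1} (\<lambda>s. \<kappa> t s * f s (u s))" if "u \<in> K" "t \<in> {0..1}" for u t
    using \<kappa>_cont fu_cont that by (intro continuous_intros)
  have fu: "0 \<le> f s (u s)" if "u \<in> K" "s \<in> {0..1}" for u s
    using f(2) u_b[OF that] that by auto
  obtain F where F: "F > 0" "\<And>s x. \<lbrakk>s \<in> {0..1}; x \<in> {0..b}\<rbrakk> \<Longrightarrow> \<bar>f s x\<bar> \<le> F"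
  proof -
    have "compact ((\<lambda>(s, x). f s x) ` ({0..1} \<times> {0..b}))"
      by (intro compact_continuous_image f_b compact_Times compact_Icc)
    then obtain F where "F > 0" "\<forall>y \<in> (\<lambda>(s, x). f s x) ` ({0..1} \<times> {0..b}). norm y \<le> F"
      using compact_imp_bounded bounded_pos by blast
    then show ?thesis using that[of F] by auto
  qed
  show ?thesis
  proof (rule cone_shell_fixed_point[of a b q T \<sigma>, folded K_def])
    fix u t assume u: "u \<in> K" and t: "t \<in> {0..(1::real)}"
    have "0 \<le> T u t"
      unfolding T_def by (rule integral_nonneg[OF integrable_continuous_real[OF int_cont[OF u t]]])
        (use \<kappa>(2) fu u t in auto)
    moreover have "q t * T u 1 \<le> T u t"
      unfolding T_def integral_mult_right[symmetric]
      by (rule integral_le[OF integrable_continuous_real integrable_continuous_real])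
        (use \<kappa>(2) fu u t \<kappa>_cont int_cont fu_cont in \<open>auto intro!: continuous_intros mult_right_mono simp flip: mult.assoc\<close>)
    moreover have "T u t \<le> T u 1"
      unfolding T_def
      by (rule integral_le[OF integrable_continuous_real integrable_continuous_real])
        (use \<kappa>(2) fu u t int_cont in \<open>auto intro!: mult_right_mono\<close>)
    ultimately show "0 \<le> T u t \<and> q t * T u 1 \<le> T u t \<and> T u t \<le> T u 1" by blast
  next
    fix t e :: real assume t: "t \<in> {0..1}" and "0 < e"
    have "0 < e / (2 * F)" using \<open>0 < e\<close> \<open>F > 0\<close> by simp
    have "uniformly_continuous_on ({0..1} \<times> {0..1}) (\<lambda>(t, s). \<kappa> t s)"
      by (intro compact_uniformly_continuous \<kappa>(1) compact_Times compact_Icc)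
    then obtain d where "d > 0" and d: "\<And>p p'. \<lbrakk>p \<in> {0..1} \<times> {0..1}; p' \<in> {0..1} \<times> {0..1}; dist p' p < d\<rbrakk>
      \<Longrightarrow> dist (case p' of (t, s) \<Rightarrow> \<kappa> t s) (case p of (t, s) \<Rightarrow> \<kappa> t s) < e / (2 * F)"
      unfolding uniformly_continuous_on_def using \<open>0 < e / (2 * F)\<close> by meson
    have "\<bar>T u t - T u t'\<bar> < e" if u: "u \<in> K" and t': "t' \<in> {0..1}" "\<bar>t - t'\<bar> < d" for u t'
    proof -
      have "\<bar>(\<kappa> t s - \<kappa> t' s) * f s (u s)\<bar> \<le> e / 2" if s: "s \<in> {0..1}" for s
      proof -
        have "\<bar>\<kappa> t s - \<kappa> t' s\<bar> \<le> e / (2 * F)"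
          using d[of "(t', s)" "(t, s)"] t t' s by (simp add: dist_Pair_Pair dist_real_def)
        then have "\<bar>\<kappa> t s - \<kappa> t' s\<bar> * \<bar>f s (u s)\<bar> \<le> e / (2 * F) * F"
          using F(2)[OF s u_b[OF u s]] by (intro mult_mono) auto
        then show ?thesis using \<open>F > 0\<close> by (simp add: abs_mult)
      qed
      then have "norm (integral {0..1} (\<lambda>s. (\<kappa> t s - \<kappa> t' s) * f s (u s))) \<le> e / 2 * (1 - 0)"
        using \<kappa>_cont fu_cont[OF u] t t'(1)
        by (intro integral_bound continuous_intros) auto
      moreover have "T u t - T u t' = integral {0..1} (\<lambda>s. (\<kappa> t s - \<kappa> t' s) * f s (u s))"
        unfolding T_def left_diff_distrib
        by (rule integral_diff[symmetric]) (intro integrable_continuous_real int_cont u t t'(1))+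
      ultimately show ?thesis using \<open>0 < e\<close> by simp
    qed
    with \<open>d > 0\<close> show "\<exists>d>0. \<forall>u\<in>K. \<forall>s\<in>{0..1}. \<bar>t - s\<bar> < d \<longrightarrow> \<bar>T u t - T u s\<bar> < e"
      by blast
  next
    fix v u and t :: real
    assume v: "\<And>m::nat. v m \<in> K" and u: "u \<in> K" and lim: "uniform_limit {0..1} v u sequentially"
      and t: "t \<in> {0..1}"
    have "continuous_on ({0..1} \<times> {0..b}) (\<lambda>(s, x). \<kappa> t s * f s x)"
      using f_b unfolding split_beta
      by (intro continuous_on_mult continuous_on_compose2[OF \<kappa>_cont[OF t] continuous_on_fst[OF continuous_on_id]])
        auto
    from uniform_limit_superposition[OF this compact_Icc lim]
    have *: "uniform_limit {0..1} (\<lambda>m s. \<kappa> t s * f s (v m s)) (\<lambda>s. \<kappa> t s * f s (u s)) sequentially"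
      using u_b u v by blast
    obtain I J where IJ: "\<And>m. ((\<lambda>s. \<kappa> t s * f s (v m s)) has_integral I m) {0..1}"
      "((\<lambda>s. \<kappa> t s * f s (u s)) has_integral J) {0..1}" "I \<longlonglongrightarrow> J"
      using uniform_limit_integral[OF * int_cont[OF v t] sequentially_bot] by blast
    show "(\<lambda>m. T (v m) t) \<longlonglongrightarrow> T u t"
      unfolding T_def integral_unique[OF IJ(1)] integral_unique[OF IJ(2)] by (rule IJ(3))
  qed (use ab q inner outer that in auto)
qed

section \<open>Repeated integration and one-sided derivatives\<close>

definition primitive01 :: "(real \<Rightarrow> real) \<Rightarrow> real \<Rightarrow> real" where
  "primitive01 y t = integral {0..t} y"

lemma primitive01_zero [simp]: "primitive01 y 0 = 0"
  by (simp add: primitive01_def)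

lemma has_vector_derivative_primitive01:
  assumes "continuous_on {0..1} y" "t \<in> {0..1}"
  shows "(primitive01 y has_vector_derivative y t) (at t within {0..1})"
  using integral_has_vector_derivative[OF assms] by (simp add: primitive01_def[abs_def])

lemma continuous_on_iterated_primitive01:
  assumes "continuous_on {0..1} y"
  shows "continuous_on {0..1} ((primitive01 ^^ m) y)"
proof (induction m)
  case (Suc m)
  then show ?case
    using has_vector_derivative_continuous[OF has_vector_derivative_primitive01[OF Suc]]
    by (simp add: continuous_on_eq_continuous_within)
qed (use assms in simp)

lemma has_vector_derivative_iterated_primitive01:
  assumes "continuous_on {0..1} y" "t \<in> {0..1}"
  shows "((primitive01 ^^ Suc m) y has_vector_derivative (primitive01 ^^ m) y t) (at t within {0..1})"
  using has_vector_derivative_primitive01[OF continuous_on_iterated_primitive01[OF assms(1)] assms(2)]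
  by simp

text \<open>
  Cauchy's formula for repeated integration. It is Taylor's formula with integral remainder for
  the iterated primitive, all of whose lower derivatives vanish at \<open>0\<close>.
\<close>

lemma iterated_primitive01_eq:
  assumes y: "continuous_on {0..1} y" and t: "t \<in> {0..1}"
  shows "(primitive01 ^^ Suc m) y t = integral {0..t} (\<lambda>s. (t - s) ^ m / fact m * y s)"
proof -
  define D where "D i = (primitive01 ^^ (Suc m - i)) y" for i
  have "D 0 t = (\<Sum>i<Suc m. ((t - 0) ^ i / fact i) *\<^sub>R D i 0)
      + integral {0..t} (\<lambda>s. ((t - s) ^ (Suc m - 1) / fact (Suc m - 1)) *\<^sub>R D (Suc m) s)"
  proof (rule Taylor_integral)
    fix i s assume i: "i < Suc m" and s: "0 \<le> s" "s \<le> t"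
    then have "Suc m - i = Suc (Suc m - Suc i)" by simp
    then have "(D i has_vector_derivative D (Suc i) s) (at s within {0..1})"
      unfolding D_def using has_vector_derivative_iterated_primitive01[OF y, of s] s t by simp
    then show "(D i has_vector_derivative D (Suc i) s) (at s within {0..t})"
      by (rule has_vector_derivative_within_subset) (use t in auto)
  qed (use t in auto)
  moreover have "D i 0 = 0" if "i < Suc m" for i
    using that by (simp add: D_def Suc_diff_le less_Suc_eq_le)
  ultimately show ?thesis by (simp add: D_def)
qed

text \<open>
  Only values on \<open>[0,1]\<close> enter \<open>deriv01\<close>, so a tower of one-sided derivatives \<open>W 0, W 1, \<dots>\<close>
  determines the iterates of \<open>deriv01\<close> for every \<open>u\<close> that agrees with \<open>W 0\<close> there.
\<close>

lemma deriv01_iterate_eq: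
  assumes W: "\<And>j t. \<lbrakk>j < m; t \<in> {0..1}\<rbrakk> \<Longrightarrow> (W j has_vector_derivative W (Suc j) t) (at t within {0..1})"
    and u: "\<And>t. t \<in> {0..1} \<Longrightarrow> u t = W 0 t"
  shows "\<lbrakk>j \<le> m; t \<in> {0..1}\<rbrakk> \<Longrightarrow> (deriv01 ^^ j) u t = W j t"
proof (induction j arbitrary: t)
  case (Suc j)
  have "((deriv01 ^^ j) u has_vector_derivative W (Suc j) t) (at t within {0..1})"
    by (rule has_vector_derivative_transform[OF _ _ W]) (use Suc in auto)
  then show ?case
    using vector_derivative_within_cbox[of 0 1 t "(deriv01 ^^ j) u"] Suc.prems
    by (simp add: deriv01_def[of "(deriv01 ^^ j) u"])
qed (use u in simp)

lemma Ck01_if_derivatives: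
  assumes W: "\<And>j t. \<lbrakk>j < m; t \<in> {0..1}\<rbrakk> \<Longrightarrow> (W j has_vector_derivative W (Suc j) t) (at t within {0..1})"
    and u: "\<And>t. t \<in> {0..1} \<Longrightarrow> u t = W 0 t"
    and cont: "continuous_on {0..1} (W m)"
  shows "Ck01 m u"
  unfolding Ck01_def
proof (intro conjI allI impI)
  note eq = deriv01_iterate_eq[of m W u, OF W u]
  fix j assume "j < m"
  show "(deriv01 ^^ j) u differentiable_on {0..1}"
    unfolding differentiable_on_def
  proof
    fix t :: real assume "t \<in> {0..1}"
    have "((deriv01 ^^ j) u has_vector_derivative W (Suc j) t) (at t within {0..1})"
      by (rule has_vector_derivative_transform[OF \<open>t \<in> {0..1}\<close> _ W[OF \<open>j < m\<close> \<open>t \<in> {0..1}\<close>]])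
        (use eq \<open>j < m\<close> in auto)
    then show "(deriv01 ^^ j) u differentiable at t within {0..1}"
      by (auto simp: has_vector_derivative_def differentiable_def)
  qed
next
  show "continuous_on {0..1} ((deriv01 ^^ m) u)"
    by (rule continuous_on_eq[OF cont]) (rule deriv01_iterate_eq[of m W u m, OF W u order_refl, symmetric])
qed

section \<open>The Green function\<close>

text \<open>
  Writing the case distinction as a positive part makes joint continuity evident.
\<close>

lemma green_eq: "green t s = (t ^ 3 * (1 - s)\<^sup>2 - (max 0 (t - s)) ^ 3) / 6"
  by (auto simp: green_def max_def)

lemma continuous_on_green: "continuous_on S (\<lambda>(t, s). green t s)"
  unfolding green_eq split_beta by (intro continuous_intros) auto

lemma green_one: "green 1 s = e_fun s" if "s \<le> 1"
  using that by (simp add: green_def e_fun_def power2_eq_square power3_eq_cube algebra_simps)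

lemma e_fun_nonneg: "0 \<le> e_fun s" if "0 \<le> s"
  using that by (simp add: e_fun_def)

text \<open>
  Below the diagonal put \<open>c = 1 - s\<close> and \<open>d = t - s\<close>, so that \<open>d \<le> t * c\<close>. The lower bound is
  \<open>d^3 \<le> (t * c)^3\<close>. The upper bound follows by factoring \<open>1 - t = c - d\<close> out of
  \<open>(c^2 - c^3) - (t^3 * c^2 - d^3)\<close> and comparing \<open>c * d\<close> and \<open>d^2\<close> with \<open>t * c^2\<close> and \<open>t^2 * c^2\<close>.
\<close>

lemma green_bounds:
  assumes "t \<in> {0..1}" "s \<in> {0..1}"
  shows "t ^ 3 * e_fun s \<le> green t s" "green t s \<le> e_fun s"
proof -
  have t: "0 \<le> t" "t \<le> 1" and s: "0 \<le> s" "s \<le> 1" using assms by auto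
  have "t ^ 3 * e_fun s \<le> green t s \<and> green t s \<le> e_fun s"
  proof (cases "s \<le> t")
    case True
    define c d where "c = 1 - s" and "d = t - s"
    have d: "0 \<le> d" "d \<le> t * c" and c: "0 \<le> c"
      using True s mult_right_le_one_le[of s t] t by (auto simp: c_def d_def algebra_simps)
    have "d ^ 3 \<le> (t * c) ^ 3" using d by (intro power_mono)
    moreover have "t ^ 3 * e_fun s = (t ^ 3 * c\<^sup>2 - (t * c) ^ 3) / 6" 
      by (simp add: e_fun_def c_def power2_eq_square power3_eq_cube algebra_simps)
    moreover have green: "green t s = (t ^ 3 * c\<^sup>2 - d ^ 3) / 6"
      using True by (simp add: green_def c_def d_def)
    moreover have "green t s \<le> e_fun s"
    proof -
      have "d * c \<le> t * c * c" "d * d \<le> t * c * (t * c)"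
        using d c by (auto intro!: mult_mono)
      then have "0 \<le> (c - d) * ((t * c * c - d * c) + (t * c * (t * c) - d * d))"
        using t by (intro mult_nonneg_nonneg) (auto simp: c_def d_def)
      also have "\<dots> = (c\<^sup>2 - c ^ 3) - (t ^ 3 * c\<^sup>2 - d ^ 3)"
        unfolding c_def d_def by (simp add: power2_eq_square power3_eq_cube algebra_simps)
      also have "c\<^sup>2 - c ^ 3 = 6 * e_fun s"
        by (simp add: e_fun_def c_def power2_eq_square power3_eq_cube algebra_simps)
      finally show ?thesis using green by simp
    qed
    ultimately show ?thesis by simp
  next
    case False
    have "t ^ 3 \<le> t" using t power_decreasing[of 1 3 t] by simp
    then have "t ^ 3 \<le> s" using False by simp
    moreover have "t ^ 3 * s \<le> t ^ 3" using t s by (simp add: mult_right_le_one_le)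
    ultimately show ?thesis
      using False mult_right_mono[of "t ^ 3" s "(1 - s)\<^sup>2"] mult_right_mono[of "t ^ 3 * s" "t ^ 3" "(1 - s)\<^sup>2"]
      by (simp add: green_def e_fun_def mult.assoc)
  qed
  then show "t ^ 3 * e_fun s \<le> green t s" "green t s \<le> e_fun s" by blast+
qed

lemma green_nonneg: "0 \<le> green t s" if "t \<in> {0..1}" "s \<in> {0..1}"
proof -
  have "0 \<le> t ^ 3 * e_fun s" using that e_fun_nonneg[of s] by auto
  then show ?thesis using green_bounds(1)[OF that] by simp
qed

text \<open>
  The positive part restricts the cubic term to \<open>[0,t]\<close>, where it is a fourfold primitive.
  This form of the Green potential can be differentiated term by term.
\<close>

lemma integral_green:
  assumes y: "continuous_on {0..1} y" and t: "t \<in> {0..1}"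
  shows "integral {0..1} (\<lambda>s. green t s * y s) =
    integral {0..1} (\<lambda>s. (1 - s)\<^sup>2 * y s) * t ^ 3 / 6 - (primitive01 ^^ 4) y t"
proof -
  let ?g = "\<lambda>s. (max 0 (t - s)) ^ 3 * y s"
  have cont: "continuous_on {0..1} (\<lambda>s. (1 - s)\<^sup>2 * y s)" "continuous_on {0..1} ?g"
    by (intro continuous_intros y)+
  have "integral {0..1} (\<lambda>s. green t s * y s)
      = integral {0..1} (\<lambda>s. t ^ 3 / 6 * ((1 - s)\<^sup>2 * y s) - 1 / 6 * ?g s)"
    by (simp add: green_eq algebra_simps diff_divide_distrib)
  also have "\<dots> = t ^ 3 / 6 * integral {0..1} (\<lambda>s. (1 - s)\<^sup>2 * y s) - 1 / 6 * integral {0..1} ?g"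
    by (subst integral_diff)
       (use cont in \<open>auto simp del: times_divide_eq_left intro!: integrable_continuous_real continuous_intros y\<close>)
  also have "integral {0..1} ?g = integral {0..t} ?g + integral {t..1} ?g"
    using t cont(2) by (subst Henstock_Kurzweil_Integration.integral_combine)
      (auto intro!: integrable_continuous_real)
  also have "integral {t..1} ?g = 0"
    using Henstock_Kurzweil_Integration.integral_cong[of "{t..1}" ?g "\<lambda>_. 0"] by simp
  also have "integral {0..t} ?g = integral {0..t} (\<lambda>s. 6 * ((t - s) ^ 3 / fact 3 * y s))"
    by (rule Henstock_Kurzweil_Integration.integral_cong) (simp add: fact_numeral)
  also have "\<dots> = 6 * (primitive01 ^^ 4) y t"
    using iterated_primitive01_eq[OF y t, of 3] by (simp add: numeral_eq_Suc)
  finally show ?thesis by simp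
qed

text \<open>
  The integral of \<open>green t s\<close> over \<open>t \<in> [0,1]\<close>.
\<close>

definition green_mean :: "real \<Rightarrow> real" where
  "green_mean s = s * (1 - s)\<^sup>2 * (2 - s) / 24"

text \<open>
  \<open>\<Psi>\<close> contains \<open>e_fun\<close> where the exact kernel has \<open>green_mean\<close>; this comparison is the price of
  passing from one to the other.
\<close>

lemma e_fun_le_green_mean: "e_fun s \<le> 4 * green_mean s" if "s \<in> {0..1}"
  using mult_left_mono[of 1 "2 - s" "e_fun s"] e_fun_nonneg[of s] that
  by (simp add: green_mean_def e_fun_def mult_ac)

text \<open>
  By \<open>integral_green\<close> the function \<open>u\<close> is \<open>c + A * t^3 / 6\<close> minus the fourfold primitive of \<open>y\<close>,
  and \<open>W\<close> lists its derivatives. The condition at \<open>1\<close> holds since the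
  threefold primitive of \<open>y\<close> has the value \<open>A / 2\<close> there. The mean value of \<open>u\<close> comes from the fivefold
  primitive, whose value at \<open>1\<close> is an integral against \<open>(1 - s)^4 / 24\<close>, and
  \<open>((1 - s)^2 - (1 - s)^4) / 24 = green_mean s\<close>.
\<close>

lemma green_potential_properties:
  assumes y: "continuous_on {0..1} y"
  defines "A \<equiv> integral {0..1} (\<lambda>s. (1 - s)\<^sup>2 * y s)"
  assumes u: "\<And>t. t \<in> {0..1} \<Longrightarrow> u t = c + integral {0..1} (\<lambda>s. green t s * y s)"
  shows "Ck01 4 u"
    and "\<And>t. t \<in> {0..1} \<Longrightarrow> (deriv01 ^^ 4) u t = - y t"
    and "deriv01 u 0 = 0" and "deriv01 u 1 = 0" and "(deriv01 ^^ 2) u 0 = 0"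
    and "u 0 = c"
    and "integral {0..1} u = c + integral {0..1} (\<lambda>s. green_mean s * y s)"
proof -
  let ?J = "\<lambda>m. (primitive01 ^^ m) y"
  define W where "W j t = (if j = 0 then c + A * t ^ 3 / 6 - ?J 4 t
      else if j = 1 then A * t\<^sup>2 / 2 - ?J 3 t
      else if j = 2 then A * t - ?J 2 t
      else if j = 3 then A - ?J 1 t else - y t)" for j :: nat and t
  have J: "(?J 4 has_vector_derivative ?J 3 t) (at t within {0..1})"
    "(?J 3 has_vector_derivative ?J 2 t) (at t within {0..1})"
    "(?J 2 has_vector_derivative ?J 1 t) (at t within {0..1})"
    "(?J 1 has_vector_derivative y t) (at t within {0..1})" if "t \<in> {0..1}" for t
    using has_vector_derivative_iterated_primitive01[OF y that, of 3]
      has_vector_derivative_iterated_primitive01[OF y that, of 2]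
      has_vector_derivative_iterated_primitive01[OF y that, of 1]
      has_vector_derivative_iterated_primitive01[OF y that, of 0]
    by (simp_all add: numeral_eq_Suc)
  have W_deriv: "(W j has_vector_derivative W (Suc j) t) (at t within {0..1})"
    if "j < 4" and t: "t \<in> {0..1}" for j t
  proof -
    have poly: "((\<lambda>t. c + A * t ^ 3 / 6) has_vector_derivative A * t\<^sup>2 / 2) (at t within {0..1})"
      "((\<lambda>t. A * t\<^sup>2 / 2) has_vector_derivative A * t) (at t within {0..1})"
      "((\<lambda>t. A * t) has_vector_derivative A) (at t within {0..1})"
      "((\<lambda>t. A) has_vector_derivative 0) (at t within {0..1})"
      by (auto intro!: derivative_eq_intros simp flip: has_real_derivative_iff_has_vector_derivative)
    consider "j = 0" | "j = 1" | "j = 2" | "j = 3" using \<open>j < 4\<close> by linarith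
    then show ?thesis
      using poly[THEN has_vector_derivative_diff] J[OF t]
      by cases (auto simp: W_def[abs_def] )
  qed
  have u_W: "u t = W 0 t" if "t \<in> {0..1}" for t
    using u[OF that] integral_green[OF y that] by (simp add: W_def A_def)
  have deriv: "(deriv01 ^^ j) u t = W j t" if "j \<le> 4" "t \<in> {0..1}" for j t
    by (rule deriv01_iterate_eq[of 4 W u, OF W_deriv u_W that]) auto
  show "Ck01 4 u"
  proof (rule Ck01_if_derivatives[OF W_deriv u_W])
    show "continuous_on {0..1} (W 4)"
      using y by (simp add: W_def[abs_def] continuous_on_minus)
  qed auto
  show "(deriv01 ^^ 4) u t = - y t" if "t \<in> {0..1}" for t
    using deriv[of 4 t] that by (simp add: W_def)
  have J0: "?J (Suc m) 0 = 0" for m by simp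
  show "deriv01 u 0 = 0"
    using deriv[of 1 0] J0[of 2] by (simp add: W_def numeral_eq_Suc)
  show "(deriv01 ^^ 2) u 0 = 0"
    using deriv[of 2 0] J0[of 1] by (simp add: W_def numeral_eq_Suc)
  show "u 0 = c"
    using u_W[of 0] J0[of 3] by (simp add: W_def numeral_eq_Suc)
  have one: "(1::real) \<in> {0..1}" by simp
  have "?J 3 1 = integral {0..1} (\<lambda>s. 1 / 2 * ((1 - s)\<^sup>2 * y s))"
    using iterated_primitive01_eq[OF y one, of 2] by (simp add: numeral_eq_Suc)
  then have "?J 3 1 = A / 2" by (simp add: A_def)
  then show "deriv01 u 1 = 0"
    using deriv[of 1 1] by (simp add: W_def)
  have J5: "?J 5 1 = integral {0..1} (\<lambda>s. 1 / 24 * ((1 - s) ^ 4 * y s))"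
    using iterated_primitive01_eq[OF y one, of 4] by (simp add: numeral_eq_Suc)
  have "integral {0..1} u = integral {0..1} (\<lambda>t. (c + A / 6 * t ^ 3) - ?J 4 t)"
    by (rule Henstock_Kurzweil_Integration.integral_cong) (simp add: u_W W_def)
  also have "\<dots> = integral {0..1} (\<lambda>t. c + A / 6 * t ^ 3) - integral {0..1} (?J 4)"
    by (intro integral_diff integrable_continuous_real continuous_intros
        continuous_on_iterated_primitive01 y)
  also have "integral {0..1} (\<lambda>t. c + A / 6 * t ^ 3) = c + A / 24"
  proof (rule integral_unique)
    have "((\<lambda>t. c + A / 6 * t ^ 3) has_integral ((c * 1 + A / 24 * 1 ^ 4) - (c * 0 + A / 24 * 0 ^ 4))) {0..1}"
      by (rule fundamental_theorem_of_calculus)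
        (auto intro!: derivative_eq_intros simp flip: has_real_derivative_iff_has_vector_derivative)
    then show "((\<lambda>t. c + A / 6 * t ^ 3) has_integral c + A / 24) {0..1}" by simp
  qed
  also have "integral {0..1} (?J 4) = ?J 5 1"
    by (simp add: primitive01_def numeral_eq_Suc)
  also have "c + A / 24 - ?J 5 1 = c + (integral {0..1} (\<lambda>s. 1 / 24 * ((1 - s)\<^sup>2 * y s))
      - integral {0..1} (\<lambda>s. 1 / 24 * ((1 - s) ^ 4 * y s)))"
    unfolding J5 A_def by simp
  also have "\<dots> = c + integral {0..1} (\<lambda>s. 1 / 24 * ((1 - s)\<^sup>2 * y s) - 1 / 24 * ((1 - s) ^ 4 * y s))"
    by (subst integral_diff) (intro integrable_continuous_real continuous_intros y refl)+
  also have "(\<lambda>s. 1 / 24 * ((1 - s)\<^sup>2 * y s) - 1 / 24 * ((1 - s) ^ 4 * y s)) = (\<lambda>s. green_mean s * y s)"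
    by (auto simp: green_mean_def power2_eq_square power4_eq_xxxx algebra_simps)
  finally show "integral {0..1} u = c + integral {0..1} (\<lambda>s. green_mean s * y s)" .
qed

section \<open>The integral equation of the boundary value problem\<close>

text \<open>
  The kernel of the functional \<open>y \<mapsto> u 0\<close>: inserting \<open>u t = u 0 + \<integral> green t s * y s ds\<close> in the
  nonlocal condition gives a linear equation for \<open>u 0\<close> with coefficient \<open>k_const\<close>.
\<close>

definition boundary_weight ::
  "nat \<Rightarrow> real \<Rightarrow> (nat \<Rightarrow> real) \<Rightarrow> (nat \<Rightarrow> real) \<Rightarrow> real \<Rightarrow> real" where
  "boundary_weight n \<alpha> \<beta> \<eta> s =
     (\<alpha> * green_mean s + (\<Sum>i=1..n. \<beta> i * green (\<eta> i) s)) / k_const n \<alpha> \<beta>"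

definition nonlocal_green ::
  "nat \<Rightarrow> real \<Rightarrow> (nat \<Rightarrow> real) \<Rightarrow> (nat \<Rightarrow> real) \<Rightarrow> real \<Rightarrow> real \<Rightarrow> real" where
  "nonlocal_green n \<alpha> \<beta> \<eta> t s = green t s + boundary_weight n \<alpha> \<beta> \<eta> s"

lemma continuous_on_green_section: "continuous_on S (green t)"
  unfolding green_eq[abs_def] by (intro continuous_intros) auto

lemma continuous_on_green_mean: "continuous_on S green_mean"
  unfolding green_mean_def[abs_def] by (intro continuous_intros) auto

lemma continuous_on_boundary_weight: "continuous_on S (boundary_weight n \<alpha> \<beta> \<eta>)"
  unfolding boundary_weight_def[abs_def] divide_inverse
  by (intro continuous_intros continuous_on_green_section continuous_on_green_mean)

lemma bvp_solution_if_integral_equation: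
  assumes k: "k_const n \<alpha> \<beta> \<noteq> 0" and \<eta>: "\<And>i. i \<in> {1..n} \<Longrightarrow> \<eta> i \<in> {0..1}"
    and f: "continuous_on {0..1} (\<lambda>s. f s (u s))"
    and u: "\<And>t. t \<in> {0..1} \<Longrightarrow> 0 \<le> u t"
      "\<And>t. t \<in> {0..1} \<Longrightarrow> u t = integral {0..1} (\<lambda>s. nonlocal_green n \<alpha> \<beta> \<eta> t s * f s (u s))"
  shows "bvp_solution f n \<alpha> \<beta> \<eta> u"
proof -
  define y where "y s = f s (u s)" for s
  define k where "k = k_const n \<alpha> \<beta>"
  define c where "c = integral {0..1} (\<lambda>s. boundary_weight n \<alpha> \<beta> \<eta> s * y s)"
  have y: "continuous_on {0..1} y" using f by (simp add: y_def)
  note cont = continuous_on_green_section continuous_on_green_mean continuous_on_boundary_weight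
  have u_eq: "u t = c + integral {0..1} (\<lambda>s. green t s * y s)" if "t \<in> {0..1}" for t
  proof -
    have "u t = integral {0..1} (\<lambda>s. boundary_weight n \<alpha> \<beta> \<eta> s * y s + green t s * y s)"
      using u(2)[OF that] by (simp add: y_def nonlocal_green_def algebra_simps)
    also have "\<dots> = c + integral {0..1} (\<lambda>s. green t s * y s)"
      unfolding c_def
      by (rule integral_add) (intro integrable_continuous_real continuous_intros y cont)+
    finally show ?thesis .
  qed
  note props = green_potential_properties[OF y u_eq]
  have "k * c = integral {0..1} (\<lambda>s. k * (boundary_weight n \<alpha> \<beta> \<eta> s * y s))"
    by (simp add: c_def)
  also have "\<dots> = integral {0..1} (\<lambda>s. \<alpha> * (green_mean s * y s) + (\<Sum>i=1..n. \<beta> i * (green (\<eta> i) s * y s)))"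
    using k by (simp add: boundary_weight_def k_def distrib_right sum_distrib_right mult.assoc)
  also have "\<dots> = \<alpha> * integral {0..1} (\<lambda>s. green_mean s * y s)
      + (\<Sum>i=1..n. \<beta> i * integral {0..1} (\<lambda>s. green (\<eta> i) s * y s))"
    by (subst integral_add, (intro integrable_continuous_real continuous_intros y cont)+)
      (subst integral_sum, auto intro!: integrable_continuous_real continuous_intros y cont)
  also have "\<dots> = \<alpha> * (integral {0..1} u - c) + (\<Sum>i=1..n. \<beta> i * (u (\<eta> i) - c))"
    using props(7) u_eq[OF \<eta>] by simp
  also have "\<dots> = \<alpha> * integral {0..1} u + (\<Sum>i=1..n. \<beta> i * u (\<eta> i)) - (\<alpha> + (\<Sum>i=1..n. \<beta> i)) * c"
    by (simp add: algebra_simps sum_subtractf sum_distrib_left)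
  finally have "c = \<alpha> * integral {0..1} u + (\<Sum>i=1..n. \<beta> i * u (\<eta> i))"
    by (simp add: k_def k_const_def algebra_simps)
  then show ?thesis
    using props u(1) by (auto simp: bvp_solution_def y_def)
qed

lemma boundary_weight_nonneg:
  assumes "0 < k_const n \<alpha> \<beta>" "0 \<le> \<alpha>" "\<And>i. i \<in> {1..n} \<Longrightarrow> 0 \<le> \<beta> i \<and> \<eta> i \<in> {0..1}" "s \<in> {0..1}"
  shows "0 \<le> boundary_weight n \<alpha> \<beta> \<eta> s"
proof -
  have "0 \<le> green (\<eta> i) s" if "i \<in> {1..n}" for i
    using green_nonneg[of "\<eta> i" s] assms(3)[OF that] assms(4) by blast
  moreover have "0 \<le> green_mean s" using e_fun_le_green_mean[OF assms(4)] e_fun_nonneg[of s] assms(4) by auto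
  ultimately show ?thesis
    using assms unfolding boundary_weight_def
    by (intro divide_nonneg_pos add_nonneg_nonneg sum_nonneg mult_nonneg_nonneg) auto
qed

text \<open>
  A nonnegative term that does not depend on \<open>t\<close> preserves both bounds of \<open>green_bounds\<close>, because
  \<open>t^3 \<le> 1\<close>.
\<close>

lemma nonlocal_green_bounds:
  assumes "0 \<le> boundary_weight n \<alpha> \<beta> \<eta> s" "t \<in> {0..1}" "s \<in> {0..1}"
  shows "0 \<le> nonlocal_green n \<alpha> \<beta> \<eta> t s \<and> t ^ 3 * nonlocal_green n \<alpha> \<beta> \<eta> 1 s \<le> nonlocal_green n \<alpha> \<beta> \<eta> t s \<and>
    nonlocal_green n \<alpha> \<beta> \<eta> t s \<le> nonlocal_green n \<alpha> \<beta> \<eta> 1 s"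
proof -
  have t: "0 \<le> t ^ 3" "t ^ 3 \<le> 1" using assms(2) by (auto simp: power_le_one)
  have "t ^ 3 * boundary_weight n \<alpha> \<beta> \<eta> s \<le> boundary_weight n \<alpha> \<beta> \<eta> s"
    using t assms(1) by (simp add: mult_left_le_one_le)
  moreover have "0 \<le> t ^ 3 * e_fun s" using t e_fun_nonneg assms(3) by auto
  ultimately show ?thesis
    using green_bounds[OF assms(2,3)] green_one[of s] assms(1,3)
    by (auto simp: nonlocal_green_def distrib_left)
qed

section \<open>Sublinear growth\<close>

lemma quot_le_max_quot:
  assumes f: "continuous_on ({0..1} \<times> {0..}) (\<lambda>(t, u). f t u)" and "0 < u" "t \<in> {0..1}"
  shows "f t u \<le> max_quot f u * u"
proof -
  have "continuous_on {0..1} (\<lambda>t. f t u)"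
    using continuous_on_compose2[OF f continuous_on_Pair[OF continuous_on_id continuous_on_const[of _ u]], of "{0..1}"]
      \<open>0 < u\<close> by (auto simp: image_subset_iff)
  then have "continuous_on {0..1} (\<lambda>t. f t u / u)"
    using \<open>0 < u\<close> by (intro continuous_intros) auto
  then have "bdd_above ((\<lambda>t. f t u / u) ` {0..1})"
    by (intro bounded_imp_bdd_above compact_imp_bounded compact_continuous_image compact_Icc)
  then have "f t u / u \<le> max_quot f u"
    unfolding max_quot_def using \<open>t \<in> {0..1}\<close> by (rule cSUP_upper2) auto
  then show ?thesis using \<open>0 < u\<close> by (simp add: divide_simps)
qed

text \<open>
  The bound for \<open>u > 0\<close> is the limit hypothesis; the value \<open>u = 0\<close>, where the quotient says nothing,
  is reached by continuity.
\<close>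

lemma sublinear_at_zero:
  assumes f: "continuous_on ({0..1} \<times> {0..}) (\<lambda>(t, u). f t u)"
    and "has_f_zero f 0" and "0 < e" "0 < r"
  obtains a where "0 < a" "a < r" "\<And>t u. \<lbrakk>t \<in> {0..1}; u \<in> {0..a}\<rbrakk> \<Longrightarrow> f t u \<le> e * a"
proof -
  have "\<forall>\<^sub>F u in at_right 0. ereal (max_quot f u) < ereal e"
    by (rule order_tendstoD(2)[OF assms(2)[unfolded has_f_zero_def]]) (use \<open>0 < e\<close> in simp)
  then obtain d where "d > 0" and d: "\<And>u. \<lbrakk>0 < u; u < d\<rbrakk> \<Longrightarrow> max_quot f u < e"
    unfolding eventually_at_right_field by auto
  define a where "a = min d r / 2"
  have a: "0 < a" "a < d" "a < r" using \<open>0 < d\<close> \<open>0 < r\<close> by (auto simp: a_def)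
  have pos: "f t u \<le> e * a" if "t \<in> {0..1}" "u \<in> {0<..a}" for t u
  proof -
    have "f t u \<le> max_quot f u * u" using quot_le_max_quot[OF f] that by simp
    also have "\<dots> \<le> e * a" using d[of u] that a \<open>0 < e\<close>
      by (intro order_trans[OF mult_right_mono[of _ e] mult_left_mono]) auto
    finally show ?thesis .
  qed
  have "f t u \<le> e * a" if "t \<in> {0..1}" "u \<in> {0..a}" for t u
  proof (rule continuous_le_on_closure[of "{0<..a}" "f t"])
    show "continuous_on (closure {0<..a}) (f t)"
      using continuous_on_compose2[OF f continuous_on_Pair[OF continuous_on_const[of _ t] continuous_on_id], of "{0..a}"]
        that a by (auto simp: image_subset_iff closure_greaterThanAtMost)
  qed (use that pos a in \<open>auto simp: closure_greaterThanAtMost\<close>)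
  with a show ?thesis using that by blast
qed

text \<open>
  On a compact range of \<open>u\<close> the function \<open>f\<close> is bounded by some \<open>F\<close>, which is absorbed
  by taking \<open>b \<ge> F / e\<close>.
\<close>

lemma sublinear_at_infinity:
  assumes f: "continuous_on ({0..1} \<times> {0..}) (\<lambda>(t, u). f t u)"
    and "has_f_infty f 0" and "0 < e"
  obtains b where "r < b" "\<And>t u. \<lbrakk>t \<in> {0..1}; u \<in> {0..b}\<rbrakk> \<Longrightarrow> f t u \<le> e * b"
proof -
  have "\<forall>\<^sub>F u in at_top. ereal (max_quot f u) < ereal e"
    by (rule order_tendstoD(2)[OF assms(2)[unfolded has_f_infty_def]]) (use \<open>0 < e\<close> in simp)
  then obtain B0 where B0: "\<And>u. B0 \<le> u \<Longrightarrow> max_quot f u < e"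
    unfolding eventually_at_top_linorder by auto
  define B where "B = max 1 B0"
  have "compact ((\<lambda>(t, u). f t u) ` ({0..1} \<times> {0..B}))"
    by (intro compact_continuous_image compact_Times compact_Icc continuous_on_subset[OF f]) auto
  then obtain F where F: "\<And>t u. \<lbrakk>t \<in> {0..1}; u \<in> {0..B}\<rbrakk> \<Longrightarrow> f t u \<le> F"
    using bounded_imp_bdd_above[OF compact_imp_bounded] unfolding bdd_above_def by fast
  define b where "b = max (r + 1) (max B (F / e))"
  have "f t u \<le> e * b" if t: "t \<in> {0..1}" and u: "u \<in> {0..b}" for t u
  proof (cases "u \<le> B")
    case True
    then have "f t u \<le> F" using F t u by auto
    also have "F \<le> e * b"
      using mult_left_mono[of "F / e" b e] \<open>0 < e\<close> by (simp add: b_def)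
    finally show ?thesis .
  next
    case False
    then have "f t u \<le> max_quot f u * u" using quot_le_max_quot[OF f _ t] by (simp add: B_def)
    also have "\<dots> \<le> e * b" using B0[of u] False u \<open>0 < e\<close>
      by (intro order_trans[OF mult_right_mono[of _ e] mult_left_mono]) (auto simp: B_def less_imp_le)
    finally show ?thesis .
  qed
  moreover have "r < b" by (auto simp: b_def)
  ultimately show ?thesis using that by blast
qed

section \<open>Two positive solutions\<close>

lemma sup_norm01_eq_end_value:
  assumes "\<And>t. t \<in> {0..1} \<Longrightarrow> 0 \<le> u t \<and> u t \<le> u 1"
  shows "sup_norm01 u = u 1"
  unfolding sup_norm01_def
  by (rule cSup_eq_maximum) (use assms in \<open>force+\<close>)

text \<open>
  The integrand \<open>I\<close> of \<open>\<Psi>\<close> is at most four times the kernel at \<open>t = 1\<close>, by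
  \<open>e_fun_le_green_mean\<close>, and the factor \<open>c\<close> in front of the integral is at most
  \<open>(1/2)^6 < 1/4\<close>. Strictness needs a positive integral of \<open>I\<close>, hence the
  lower bound \<open>\<theta>^3 / 6\<close> for \<open>e_fun\<close>.
\<close>

lemma Psi_pos_less_integral:
  assumes \<theta>: "\<theta> \<in> {0<..<1/2}" and "0 < k_const n \<alpha> \<beta>" "0 \<le> \<alpha>"
    and \<beta>: "\<And>i. i \<in> {1..n} \<Longrightarrow> 0 \<le> \<beta> i \<and> \<eta> i \<in> {0..1}"
  shows "0 < Psi n \<alpha> \<beta> \<eta> \<theta>"
    and "Psi n \<alpha> \<beta> \<eta> \<theta> < integral {\<theta>..1 - \<theta>} (nonlocal_green n \<alpha> \<beta> \<eta> 1)"
proof -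
  let ?k = "k_const n \<alpha> \<beta>"
  define I where "I s = (1 + \<alpha> / ?k) * e_fun s + 1 / ?k * (\<Sum>i=1..n. \<beta> i * green (\<eta> i) s)" for s
  define c where "c = \<theta> ^ 6 * (1 - 2 * \<theta>)\<^sup>2"
  have Psi: "Psi n \<alpha> \<beta> \<eta> \<theta> = c * integral {\<theta>..1 - \<theta>} I"
    by (simp add: Psi_def I_def[abs_def] c_def)
  have e_cont: "continuous_on S e_fun" for S
    unfolding e_fun_def[abs_def] by (intro continuous_intros)
  have I_int: "I integrable_on {\<theta>..1 - \<theta>}"
    unfolding I_def[abs_def] by (intro integrable_continuous_real continuous_intros e_cont continuous_on_green_section)
  have kernel_int: "nonlocal_green n \<alpha> \<beta> \<eta> 1 integrable_on {\<theta>..1 - \<theta>}"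
    unfolding nonlocal_green_def[abs_def]
    by (intro integrable_continuous_real continuous_intros continuous_on_green_section continuous_on_boundary_weight)
  have s01: "s \<in> {0..1}" if "s \<in> {\<theta>..1 - \<theta>}" for s using that \<theta> by auto
  have S: "0 \<le> (\<Sum>i=1..n. \<beta> i * green (\<eta> i) s)" if s: "s \<in> {0..1}" for s
    using green_nonneg[OF _ s] \<beta> by (intro sum_nonneg mult_nonneg_nonneg) auto
  have "\<theta> ^ 3 / 6 \<le> I s" if s: "s \<in> {\<theta>..1 - \<theta>}" for s
  proof -
    have "\<theta>\<^sup>2 \<le> (1 - s)\<^sup>2" using s \<theta> by (intro power_mono) auto
    then have "\<theta> * \<theta>\<^sup>2 \<le> s * (1 - s)\<^sup>2" using s \<theta> by (intro mult_mono) auto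
    then have "\<theta> ^ 3 / 6 \<le> e_fun s" by (simp add: e_fun_def power3_eq_cube power2_eq_square)
    also have "\<dots> \<le> (1 + \<alpha> / ?k) * e_fun s"
      using assms(2,3) e_fun_nonneg[of s] s01[OF s] by (simp add: mult_le_cancel_right1)
    also have "\<dots> \<le> I s" using S[OF s01[OF s]] assms(2) by (simp add: I_def)
    finally show ?thesis .
  qed
  then have "integral {\<theta>..1 - \<theta>} (\<lambda>_. \<theta> ^ 3 / 6) \<le> integral {\<theta>..1 - \<theta>} I"
    by (intro integral_le I_int integrable_const_ivl)
  moreover have "0 < (1 - 2 * \<theta>) * (\<theta> ^ 3 / 6)" using \<theta> by simp
  moreover have "integral {\<theta>..1 - \<theta>} (\<lambda>_. \<theta> ^ 3 / 6) = (1 - 2 * \<theta>) * (\<theta> ^ 3 / 6)" using \<theta> by simp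
  ultimately have I_pos: "0 < integral {\<theta>..1 - \<theta>} I" by linarith
  have c: "0 < c" "c < 1 / 4"
  proof -
    show "0 < c" using \<theta> by (simp add: c_def)
    have "\<theta> ^ 6 \<le> (1 / 2) ^ 6" "(1 - 2 * \<theta>)\<^sup>2 \<le> 1" using \<theta> by (intro power_mono power_le_one; auto)+
    then have "c \<le> (1 / 2) ^ 6 * 1" unfolding c_def by (intro mult_mono) auto
    then show "c < 1 / 4" by (simp add: power_divide)
  qed
  show "0 < Psi n \<alpha> \<beta> \<eta> \<theta>" using Psi c I_pos by simp
  have "I s \<le> 4 * nonlocal_green n \<alpha> \<beta> \<eta> 1 s" if "s \<in> {\<theta>..1 - \<theta>}" for s
  proof -
    note s = s01[OF that]
    have "4 * nonlocal_green n \<alpha> \<beta> \<eta> 1 s - I s = 3 * e_fun s + \<alpha> / ?k * (4 * green_mean s - e_fun s)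
        + 3 / ?k * (\<Sum>i=1..n. \<beta> i * green (\<eta> i) s)"
      using green_one[of s] s assms(2)
      by (simp add: nonlocal_green_def I_def boundary_weight_def field_simps)
    also have "\<dots> \<ge> 0"
      using e_fun_le_green_mean[OF s] e_fun_nonneg[of s] S[OF s] s assms(2,3) by auto
    finally show ?thesis by simp
  qed
  then have "integral {\<theta>..1 - \<theta>} I \<le> integral {\<theta>..1 - \<theta>} (\<lambda>s. 4 * nonlocal_green n \<alpha> \<beta> \<eta> 1 s)"
    using kernel_int by (intro integral_le I_int integrable_on_mult_right) auto
  moreover have "c * integral {\<theta>..1 - \<theta>} I < 1 / 4 * integral {\<theta>..1 - \<theta>} I"
    using c I_pos by (intro mult_strict_right_mono)
  ultimately show "Psi n \<alpha> \<beta> \<eta> \<theta> < integral {\<theta>..1 - \<theta>} (nonlocal_green n \<alpha> \<beta> \<eta> 1)"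
    by (simp add: Psi)
qed

theorem theorem4p2:
  fixes n :: nat and f :: "real \<Rightarrow> real \<Rightarrow> real"
    and \<alpha> \<theta> \<rho>\<^sub>2 M\<^sub>2 :: real and \<beta> \<eta> :: "nat \<Rightarrow> real"
  assumes "n \<ge> 1"
    and "continuous_on ({0..1} \<times> {0..}) (\<lambda>(t, u). f t u)"
    and "\<And>t u. t \<in> {0..1} \<Longrightarrow> u \<ge> 0 \<Longrightarrow> f t u \<ge> 0"
    and "\<alpha> \<ge> 0"
    and "\<And>i. i \<in> {1..n} \<Longrightarrow> \<beta> i \<ge> 0"
    and "0 < \<eta> 1" and "strict_mono_on {1..n} \<eta>" and "\<eta> n < 1"
    and "\<alpha> + (\<Sum>i=1..n. \<beta> i) < 1"
    and "\<theta> \<in> {0<..<1/2}"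
    and "has_f_zero f 0" and "has_f_infty f 0"
    and "\<rho>\<^sub>2 > 0" and "M\<^sub>2 \<in> {Lambda2 n \<alpha> \<beta> \<eta> \<theta>..}"
    and "\<And>t u. u \<in> {\<theta>^3 * (1 - 2 * \<theta>) * \<rho>\<^sub>2..\<rho>\<^sub>2} \<Longrightarrow> t \<in> {\<theta>..1 - \<theta>} \<Longrightarrow> f t u \<ge> M\<^sub>2 * \<rho>\<^sub>2"
  shows "\<exists>u\<^sub>1 u\<^sub>2. positive_bvp_solution f n \<alpha> \<beta> \<eta> u\<^sub>1 \<and> positive_bvp_solution f n \<alpha> \<beta> \<eta> u\<^sub>2 \<and>
           0 < sup_norm01 u\<^sub>1 \<and> sup_norm01 u\<^sub>1 < \<rho>\<^sub>2 \<and> \<rho>\<^sub>2 < sup_norm01 u\<^sub>2"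
proof -
  note f = assms(2,3) and \<theta> = assms(10)
  have \<eta>: "\<eta> i \<in> {0..1}" if "i \<in> {1..n}" for i
    using strict_mono_onD[OF assms(7), of 1 i] strict_mono_onD[OF assms(7), of i n] assms(6,8) that
    by (cases "i = 1"; cases "i = n") auto
  have k: "0 < k_const n \<alpha> \<beta>" using assms(9) by (simp add: k_const_def)
  let ?\<kappa> = "nonlocal_green n \<alpha> \<beta> \<eta>"
  define T where "T = (\<lambda>u t. integral {0..1} (\<lambda>s. ?\<kappa> t s * f s (u s)))"
  define C where "C = integral {0..1} (?\<kappa> 1)"
  define e where "e = 1 / (C + 1)"
  have weight: "0 \<le> boundary_weight n \<alpha> \<beta> \<eta> s" if "s \<in> {0..1}" for s
    using boundary_weight_nonneg[OF k assms(4) _ that] assms(5) \<eta> by blast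
  have \<kappa>: "0 \<le> ?\<kappa> t s \<and> t ^ 3 * ?\<kappa> 1 s \<le> ?\<kappa> t s \<and> ?\<kappa> t s \<le> ?\<kappa> 1 s"
    if "t \<in> {0..1}" "s \<in> {0..1}" for t s
    using nonlocal_green_bounds[OF weight] that by blast
  have \<kappa>_cont: "continuous_on ({0..1} \<times> {0..1}) (\<lambda>(t, s). ?\<kappa> t s)"
    unfolding nonlocal_green_def split_beta
    by (intro continuous_on_add continuous_on_green[unfolded split_beta]
        continuous_on_compose2[OF continuous_on_boundary_weight[of UNIV] continuous_on_snd[OF continuous_on_id]])
      auto
  have \<kappa>1_cont: "continuous_on S (?\<kappa> 1)" for S
    unfolding nonlocal_green_def[abs_def]
    by (intro continuous_intros continuous_on_green_section continuous_on_boundary_weight)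
  have "0 \<le> C"
    unfolding C_def by (intro integral_nonneg integrable_continuous_real \<kappa>1_cont) (use \<kappa> in auto)
  then have e: "0 < e" "e * C < 1" by (auto simp: e_def divide_simps)
  define K where "K a b = {u. continuous_on {0..1} u \<and>
      (\<forall>t\<in>{0..1}. t ^ 3 * u 1 \<le> u t \<and> u t \<le> u 1) \<and> u 1 \<in> {a..b}}" for a b :: real
  have K_nonneg: "0 \<le> u s" if "u \<in> K a b" "0 < a" "s \<in> {0..1}" for u a b s
  proof -
    have "0 \<le> s ^ 3 * u 1" using that by (auto simp: K_def)
    also have "\<dots> \<le> u s" using that by (auto simp: K_def)
    finally show ?thesis .
  qed
  have fu_cont: "continuous_on {0..1} (\<lambda>s. f s (u s))" if "u \<in> K a b" "0 < a" for u a b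
    by (rule continuous_on_superposition[OF f(1)]) (use that K_nonneg in \<open>auto simp: K_def\<close>)
  have int: "(\<lambda>s. ?\<kappa> 1 s * f s (u s)) integrable_on {x..y}"
    if "u \<in> K a b" "0 < a" "{x..y} \<subseteq> {0..1}" for u a b x y
    using continuous_on_subset[OF fu_cont[OF that(1,2)] that(3)]
    by (intro integrable_continuous_real continuous_intros \<kappa>1_cont)

  \<comment> \<open>The constant \<open>e\<close> is chosen so that \<open>f \<le> e * r\<close> makes the integral at most \<open>e * C * r < r\<close>.\<close>
  have contract: "T u 1 < r"
    if u: "u \<in> K a b" "0 < a" "u 1 = r" and le: "\<And>t x. \<lbrakk>t \<in> {0..1}; x \<in> {0..r}\<rbrakk> \<Longrightarrow> f t x \<le> e * r"
    for u a b r
  proof -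
    have "f s (u s) \<le> e * r" if "s \<in> {0..1}" for s
      by (rule le) (use that K_nonneg[OF u(1,2) that] u in \<open>auto simp: K_def\<close>)
    then have "T u 1 \<le> integral {0..1} (\<lambda>s. ?\<kappa> 1 s * (e * r))"
      unfolding T_def using \<kappa>
      by (intro integral_le int[OF u(1,2)] integrable_continuous_real continuous_intros \<kappa>1_cont mult_left_mono)
        auto
    also have "\<dots> = (e * C) * r" by (simp add: C_def)
    also have "\<dots> < 1 * r" using e u by (intro mult_strict_right_mono) (auto simp: K_def)
    finally show ?thesis by simp
  qed

  have expand: "\<rho>\<^sub>2 < T u 1" if u: "u \<in> K a b" "0 < a" "u 1 = \<rho>\<^sub>2" for u a b
  proof -
    let ?P = "integral {\<theta>..1 - \<theta>} (?\<kappa> 1)"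
    have Psi: "0 < Psi n \<alpha> \<beta> \<eta> \<theta>" "Psi n \<alpha> \<beta> \<eta> \<theta> < ?P"
      using Psi_pos_less_integral[OF \<theta> k assms(4)] assms(5) \<eta> by blast+
    have "1 / Psi n \<alpha> \<beta> \<eta> \<theta> \<le> M\<^sub>2"
      using assms(14) by (simp add: Lambda2_def inverse_eq_divide)
    then have M: "1 \<le> Psi n \<alpha> \<beta> \<eta> \<theta> * M\<^sub>2" "0 < M\<^sub>2"
      using Psi(1) by (auto simp: divide_simps mult.commute zero_less_mult_iff intro: less_le_trans[of _ "1 / Psi n \<alpha> \<beta> \<eta> \<theta>"])
    then have "1 < ?P * M\<^sub>2" using mult_strict_right_mono[OF Psi(2), of M\<^sub>2] by linarith
    then have "\<rho>\<^sub>2 < ?P * (M\<^sub>2 * \<rho>\<^sub>2)"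
      using mult_strict_right_mono[of 1 "?P * M\<^sub>2" \<rho>\<^sub>2] assms(13) by (simp add: mult.assoc)
    also have "\<dots> = integral {\<theta>..1 - \<theta>} (\<lambda>s. ?\<kappa> 1 s * (M\<^sub>2 * \<rho>\<^sub>2))" by simp
    also have "\<dots> \<le> integral {\<theta>..1 - \<theta>} (\<lambda>s. ?\<kappa> 1 s * f s (u s))"
    proof (intro integral_le int[OF u(1,2)] integrable_continuous_real continuous_intros \<kappa>1_cont mult_left_mono)
      fix s assume s: "s \<in> {\<theta>..1 - \<theta>}"
      then have s01: "s \<in> {0..1}" using \<theta> by auto
      show "0 \<le> ?\<kappa> 1 s" using \<kappa>[of 1 s] s01 by simp
      have "\<theta> ^ 3 * (1 - 2 * \<theta>) \<le> \<theta> ^ 3 * 1" using \<theta> by (intro mult_left_mono) auto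
      also have "\<dots> \<le> s ^ 3" using s \<theta> by (auto intro: power_mono)
      finally have "\<theta> ^ 3 * (1 - 2 * \<theta>) * \<rho>\<^sub>2 \<le> s ^ 3 * \<rho>\<^sub>2" using assms(13) by (intro mult_right_mono) auto
      also have "\<dots> \<le> u s" using u(1,3) s01 by (auto simp: K_def)
      finally have "\<theta> ^ 3 * (1 - 2 * \<theta>) * \<rho>\<^sub>2 \<le> u s" .
      moreover have "u s \<le> \<rho>\<^sub>2" using u(1,3) s01 by (auto simp: K_def)
      ultimately show "M\<^sub>2 * \<rho>\<^sub>2 \<le> f s (u s)" using s by (intro assms(15)) auto
    qed (use \<theta> in auto)
    also have "\<dots> \<le> T u 1"
      unfolding T_def using \<theta> \<kappa> f(2) K_nonneg[OF u(1,2)]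
      by (intro integral_subset_le int[OF u(1,2)]) auto
    finally show ?thesis .
  qed

  have solution: "positive_bvp_solution f n \<alpha> \<beta> \<eta> u \<and> sup_norm01 u = u 1"
    if u: "u \<in> K a b" "0 < a" "\<And>t. t \<in> {0..1} \<Longrightarrow> T u t = u t" for u a b
  proof
    have "bvp_solution f n \<alpha> \<beta> \<eta> u"
      by (rule bvp_solution_if_integral_equation)
        (use k \<eta> fu_cont[OF u(1,2)] K_nonneg[OF u(1,2)] u(3) in \<open>auto simp: T_def\<close>)
    moreover have "0 < u t" if "t \<in> {0<..<1}" for t
    proof -
      have "0 < t ^ 3 * u 1" using that u(1,2) by (auto simp: K_def)
      also have "\<dots> \<le> u t" using that u(1) by (auto simp: K_def)
      finally show ?thesis .
    qed
    ultimately show "positive_bvp_solution f n \<alpha> \<beta> \<eta> u" by (simp add: positive_bvp_solution_def)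
    show "sup_norm01 u = u 1"
      by (rule sup_norm01_eq_end_value) (use K_nonneg[OF u(1,2)] u(1) in \<open>auto simp: K_def\<close>)
  qed

  have q: "continuous_on {0..1} (\<lambda>t::real. t ^ 3)" "\<And>t::real. t \<in> {0..1} \<Longrightarrow> t ^ 3 \<in> {0..1}"
    by (auto intro!: continuous_intros simp: power_le_one)
  have fixed_point: "\<exists>u\<in>K a b. a < u 1 \<and> u 1 < b \<and> (\<forall>t\<in>{0..1}. T u t = u t)"
    if "0 < a" "a < b" and "\<And>u. \<lbrakk>u \<in> K a b; u 1 = a\<rbrakk> \<Longrightarrow> 0 < \<sigma> * (T u 1 - a)"
      and "\<And>u. \<lbrakk>u \<in> K a b; u 1 = b\<rbrakk> \<Longrightarrow> \<sigma> * (T u 1 - b) < 0" for a b \<sigma>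
    by (rule hammerstein_fixed_point[OF that(1,2) q _ \<kappa>_cont \<kappa> f, folded T_def K_def, of \<sigma>])
      (use that in \<open>auto simp: T_def\<close>)

  \<comment> \<open>Between \<open>a\<close> and \<open>\<rho>\<^sub>2\<close> the operator is expansive (\<open>\<sigma> = -1\<close>), between \<open>\<rho>\<^sub>2\<close> and \<open>b\<close> compressive (\<open>\<sigma> = 1\<close>).\<close>
  obtain a where a: "0 < a" "a < \<rho>\<^sub>2" "\<And>t x. \<lbrakk>t \<in> {0..1}; x \<in> {0..a}\<rbrakk> \<Longrightarrow> f t x \<le> e * a"
    using sublinear_at_zero[OF f(1) assms(11) e(1) assms(13)] by blast
  obtain b where b: "\<rho>\<^sub>2 < b" "\<And>t x. \<lbrakk>t \<in> {0..1}; x \<in> {0..b}\<rbrakk> \<Longrightarrow> f t x \<le> e * b"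
    using sublinear_at_infinity[OF f(1) assms(12) e(1)] by blast
  obtain u\<^sub>1 where "u\<^sub>1 \<in> K a \<rho>\<^sub>2" "a < u\<^sub>1 1" "u\<^sub>1 1 < \<rho>\<^sub>2" "\<forall>t\<in>{0..1}. T u\<^sub>1 t = u\<^sub>1 t"
    using fixed_point[OF a(1,2), of "-1"] contract[OF _ a(1) _ a(3)] expand[OF _ a(1)] by force
  moreover obtain u\<^sub>2 where "u\<^sub>2 \<in> K \<rho>\<^sub>2 b" "\<rho>\<^sub>2 < u\<^sub>2 1" "u\<^sub>2 1 < b" "\<forall>t\<in>{0..1}. T u\<^sub>2 t = u\<^sub>2 t"
    using fixed_point[OF assms(13) b(1), of 1] contract[OF _ assms(13) _ b(2)] expand[OF _ assms(13)] by force
  ultimately show ?thesis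
    using solution[of u\<^sub>1 a \<rho>\<^sub>2] solution[of u\<^sub>2 \<rho>\<^sub>2 b] a(1) assms(13) by force
qed

end
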